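(* Let $B\subseteq[m]\times[n]$ be a board and $d\ge 0$ an integer. Then for every prime power $q$, $$M_d(B,q)\equiv r_d(B)+(q-1)\bigl(r_{\mathsf{ZG},d-2}(B)-r_{\mathsf{SG},d-2}(B)+r_{\mathsf{WRG},d-1}(B)+r_{\mathsf{WCG},d-1}(B)\bigr)\pmod{(q-1)^2}.$$
   Context: Notation: $[n]=\{1,\dots,n\}$. A board is a subset $B\subseteq[m]\times[n]$. The rook number $r_d(B)$ is the number of ways to choose $d$ cells of $B$ with no two in the same row or column. For a prime power $q>1$, $\mathfrak m_d(B,q)$ is the number of $m\times n$ matrices over $\mathbb F_q$ of rank $d$ whose support (set of positions of nonzero entries) is contained in $B$; $M_d(B,q)=\mathfrak m_d(B,q)/(q-1)^d$, which is known to be an integer. A bi-colored graph is a graph whose vertices are partitioned into row vertices and column vertices, every edge joining a row vertex to a column vertex; isomorphisms must preserve the two classes. For a board $B\subseteq[m]\times[n]$, $G(B)$ is the bi-colored graph with row vertices $[m]$, column vertices $[n]$, and edge set $B$. Let $\mathsf E$ be the graph with one row vertex, one column vertex and one edge, and $\mathsf E^i$ the disjoint union of $i$ copies of it. For a bi-colored graph $F$ and integer $i\ge0$, $r_{F,i}(B)$ is the number of boards $\sigma\subseteq B$ with $G(\sigma)\cong F\sqcup\mathsf E^i\sqcup R$, where $R$ is the edgeless bi-colored graph with the number of row and column vertices needed so that the totals are $m$ and $n$ ($r_{F,i}(B)=0$ if this is impossible). By convention $r_{F,i}(B)=0$ for $i<0$. The four graphs are: $\mathsf{ZG}$, with 2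 row and 2 column vertices, forming a path with 3 edges; $\mathsf{SG}$, with 2 row and 2 column vertices, forming $K_{2,2}$; $\mathsf{WCG}$, with 1 row vertex adjacent to each of 2 column vertices; $\mathsf{WRG}$, with 1 column vertex adjacent to each of 2 row vertices. *)

theory Defs
  imports "Jordan_Normal_Form.DL_Rank" "HOL-Number_Theory.Cong" "HOL-Library.Cardinality"
begin

type_synonym board = "(nat \<times> nat) set"

definition rook_number :: "nat \<Rightarrow> board \<Rightarrow> nat" where
  "rook_number d B = card {\<sigma>. \<sigma> \<subseteq> B \<and> finite \<sigma> \<and> card \<sigma> = d \<and>
     (\<forall>x\<in>\<sigma>. \<forall>y\<in>\<sigma>. x \<noteq> y \<longrightarrow> fst x \<noteq> fst y \<and> snd x \<noteq> snd y)}"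

(* Boards are indexed from 1, matrices from 0. *)
definition mat_support :: "'a::zero mat \<Rightarrow> board" where
  "mat_support A = {(Suc i, Suc j) | i j. i < dim_row A \<and> j < dim_col A \<and> A $$ (i, j) \<noteq> 0}"

(* A finite field of order q is a type of class field and finite with CARD('a) = q; such a
   cardinality is always a prime power greater than 1.  The count depends on the field
   through the type argument. *)
definition mat_count :: "'a::{field,finite} itself \<Rightarrow> nat \<Rightarrow> nat \<Rightarrow> nat \<Rightarrow> board \<Rightarrow> nat" where
  "mat_count _ m n d B =
     card {A :: 'a mat. A \<in> carrier_mat m n \<and> vec_space.rank m A = d \<and> mat_support A \<subseteq> B}"

definition norm_mat_count :: "'a::{field,finite} itself \<Rightarrow> nat \<Rightarrow> nat \<Rightarrow> nat \<Rightarrow> board \<Rightarrow> rat" where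
  "norm_mat_count F m n d B = of_nat (mat_count F m n d B) / (of_nat CARD('a) - 1) ^ d"

datatype ('r, 'c) bigraph =
  Bigraph (row_verts: "'r set") (col_verts: "'c set") (edges: "('r \<times> 'c) set")

definition bigraph_iso :: "('r, 'c) bigraph \<Rightarrow> ('s, 'd) bigraph \<Rightarrow> bool" where
  "bigraph_iso G H \<longleftrightarrow> (\<exists>f g. bij_betw f (row_verts G) (row_verts H) \<and>
     bij_betw g (col_verts G) (col_verts H) \<and>
     (\<forall>r\<in>row_verts G. \<forall>c\<in>col_verts G. (r, c) \<in> edges G \<longleftrightarrow> (f r, g c) \<in> edges H))"

definition bigraph_union ::
  "('r, 'c) bigraph \<Rightarrow> ('s, 'd) bigraph \<Rightarrow> ('r + 's, 'c + 'd) bigraph" where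
  "bigraph_union G H = Bigraph (row_verts G <+> row_verts H) (col_verts G <+> col_verts H)
     (map_prod Inl Inl ` edges G \<union> map_prod Inr Inr ` edges H)"

definition bigraph_copies :: "nat \<Rightarrow> ('r, 'c) bigraph \<Rightarrow> (nat \<times> 'r, nat \<times> 'c) bigraph" where
  "bigraph_copies i G = Bigraph ({1..i} \<times> row_verts G) ({1..i} \<times> col_verts G)
     {((k, r), (k, c)) | k r c. k \<in> {1..i} \<and> (r, c) \<in> edges G}"

definition edgeless :: "nat \<Rightarrow> nat \<Rightarrow> (nat, nat) bigraph" where
  "edgeless a b = Bigraph {1..a} {1..b} {}"

definition board_graph :: "nat \<Rightarrow> nat \<Rightarrow> board \<Rightarrow> (nat, nat) bigraph" where
  "board_graph m n B = Bigraph {1..m} {1..n} B"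

definition EG :: "(nat, nat) bigraph" where
  "EG = Bigraph {1} {1} {(1, 1)}"

definition ZG :: "(nat, nat) bigraph" where
  "ZG = Bigraph {1, 2} {1, 2} {(1, 1), (1, 2), (2, 2)}"

definition SG :: "(nat, nat) bigraph" where
  "SG = Bigraph {1, 2} {1, 2} ({1, 2} \<times> {1, 2})"

definition WCG :: "(nat, nat) bigraph" where
  "WCG = Bigraph {1} {1, 2} {(1, 1), (1, 2)}"

definition WRG :: "(nat, nat) bigraph" where
  "WRG = Bigraph {1, 2} {1} {(1, 1), (2, 1)}"

(* The isomorphism forces the sizes a, b of the edgeless part to be the ones completing the
   vertex counts to m and n; if there are none, the set is empty and the count is 0. *)
definition graph_rook_number ::
  "('r, 'c) bigraph \<Rightarrow> int \<Rightarrow> nat \<Rightarrow> nat \<Rightarrow> board \<Rightarrow> nat" where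
  "graph_rook_number F i m n B = (if i < 0 then 0 else
     card {\<sigma>. \<sigma> \<subseteq> B \<and> (\<exists>a b. bigraph_iso (board_graph m n \<sigma>)
       (bigraph_union (bigraph_union F (bigraph_copies (nat i) EG)) (edgeless a b)))})"

end

theory Submission
  imports Defs "HOL-Library.Product_Plus"
begin

text \<open>Rescaling rows and columns by nonzero scalars preserves support and rank. If \<open>F\<close> is a forest inside
  a support \<open>\<sigma>\<close>, this torus acts transitively on the nonzero values on \<open>F\<close>, so \<open>(q - 1) ^ card F\<close> divides
  the number of rank \<open>d\<close> matrices with support \<open>\<sigma>\<close>. The support of a rank \<open>d\<close> matrix contains a rook
  placement \<open>\<mu>\<close> of size \<open>d\<close>. Contract the edges of \<open>\<mu>\<close>: if two of the remaining edges do not become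
  parallel, adding them to \<open>\<mu>\<close> gives a forest with \<open>d + 2\<close> edges, and the support contributes 0 modulo
  \<open>(q - 1)\<^sup>2\<close> after division by \<open>(q - 1) ^ d\<close>. Otherwise there are at most two remaining edges, and \<open>\<sigma>\<close>
  is a rook placement or one of the four graphs together with isolated edges. An isolated edge multiplies
  the count by \<open>q - 1\<close> and raises the rank by one, so only the four graphs themselves remain: all
  matrices supported on \<open>ZG\<close>, \<open>WRG\<close> or \<open>WCG\<close> have the same rank, while the \<open>(q - 1) ^ 4\<close> matrices
  supported on \<open>SG\<close> include \<open>(q - 1) ^ 3\<close> singular ones, which accounts for the negative sign.\<close>

section \<open>Rank and rook placements\<close>

definition fun_supp :: "('b \<Rightarrow> 'a::zero) \<Rightarrow> 'b set" where
  "fun_supp f = {x. f x \<noteq> 0}"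

definition col_indep :: "('r \<times> 'c \<Rightarrow> 'a::field) \<Rightarrow> 'c set \<Rightarrow> bool" where
  "col_indep f J \<longleftrightarrow> finite J \<and>
     (\<forall>a. (\<forall>i. (\<Sum>j\<in>J. a j * f (i, j)) = 0) \<longrightarrow> (\<forall>j\<in>J. a j = 0))"

definition has_rank :: "('r \<times> 'c \<Rightarrow> 'a::field) \<Rightarrow> nat \<Rightarrow> bool" where
  "has_rank f d \<longleftrightarrow> (\<exists>J. col_indep f J \<and> card J = d) \<and> (\<forall>J. col_indep f J \<longrightarrow> card J \<le> d)"

definition rook_placement :: "('r \<times> 'c) set \<Rightarrow> bool" where
  "rook_placement \<mu> \<longleftrightarrow> finite \<mu> \<and> inj_on fst \<mu> \<and> inj_on snd \<mu>"

lemma mem_fun_supp [simp]: "x \<in> fun_supp f \<longleftrightarrow> f x \<noteq> 0"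
  by (simp add: fun_supp_def)

lemma col_indepI:
  assumes "finite J" "\<And>a j. (\<And>i. (\<Sum>j\<in>J. a j * f (i, j)) = 0) \<Longrightarrow> j \<in> J \<Longrightarrow> a j = 0"
  shows "col_indep f J"
  using assms by (simp add: col_indep_def)

lemma col_indepD:
  assumes "col_indep f J" "\<And>i. (\<Sum>j\<in>J. a j * f (i, j)) = 0" "j \<in> J"
  shows "a j = 0"
  using assms unfolding col_indep_def by blast

lemma col_indep_finite: "col_indep f J \<Longrightarrow> finite J"
  by (simp add: col_indep_def)

lemma has_rank_unique: "has_rank f d \<Longrightarrow> has_rank f d' \<Longrightarrow> d = d'"
  unfolding has_rank_def using le_antisym by blast

lemma col_indep_subset:
  assumes ind: "col_indep f J" and sub: "K \<subseteq> J"
  shows "col_indep f K"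
proof (rule col_indepI)
  show "finite K" using ind sub col_indep_finite finite_subset by blast
  fix a k assume a: "\<And>i. (\<Sum>j\<in>K. a j * f (i, j)) = 0" and k: "k \<in> K"
  let ?b = "\<lambda>j. if j \<in> K then a j else 0"
  have "(\<Sum>j\<in>J. ?b j * f (i, j)) = 0" for i
  proof -
    have "(\<Sum>j\<in>J. ?b j * f (i, j)) = (\<Sum>j\<in>K. a j * f (i, j))"
      using col_indep_finite[OF ind] sub by (intro sum.mono_neutral_cong_right) auto
    also have "\<dots> = 0" by (rule a)
    finally show ?thesis .
  qed
  then have "?b k = 0" by (rule col_indepD[OF ind]) (use sub k in blast)
  then show "a k = 0" using k by simp
qed

lemma not_col_indep_insert_combination:
  assumes "finite J" "j0 \<notin> J" "\<And>i. f (i, j0) = (\<Sum>j\<in>J. b j * f (i, j))"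
  shows "\<not> col_indep f (insert j0 J)"
proof
  assume ind: "col_indep f (insert j0 J)"
  let ?a = "\<lambda>j. if j = j0 then -1 else b j"
  have "(\<Sum>j\<in>insert j0 J. ?a j * f (i, j)) = 0" for i
  proof -
    have "(\<Sum>j\<in>J. ?a j * f (i, j)) = (\<Sum>j\<in>J. b j * f (i, j))"
      using assms(2) by (intro sum.cong) auto
    then show ?thesis using assms by simp
  qed
  from col_indepD[OF ind this] show False by fastforce
qed

lemma col_indep_subset_fun_supp:
  assumes "col_indep f J"
  shows "J \<subseteq> snd ` fun_supp f"
proof (rule ccontr)
  assume "\<not> J \<subseteq> snd ` fun_supp f"
  then obtain j where j: "j \<in> J" "j \<notin> snd ` fun_supp f" by blast
  then have "f (i, j) = 0" for i by force
  then have "\<not> col_indep f (insert j {})"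
    by (intro not_col_indep_insert_combination[where b = "\<lambda>_. 0"]) auto
  then show False using col_indep_subset[OF assms] j(1) by blast
qed

definition delete_row :: "'r \<Rightarrow> ('r \<times> 'c \<Rightarrow> 'a::zero) \<Rightarrow> 'r \<times> 'c \<Rightarrow> 'a" where
  "delete_row r f = (\<lambda>(i, j). if i = r then 0 else f (i, j))"

lemma unit_vector_combination:
  fixes f :: "'r \<times> 'c \<Rightarrow> 'a::field"
  assumes ind: "col_indep f J" and dep: "\<not> col_indep (delete_row r f) J"
  obtains b where "\<And>i. (\<Sum>j\<in>J. b j * f (i, j)) = of_bool (i = r)"
proof -
  obtain a j0 where a: "\<And>i. (\<Sum>j\<in>J. a j * delete_row r f (i, j)) = 0" and j0: "j0 \<in> J" "a j0 \<noteq> 0"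
    using dep col_indep_finite[OF ind] unfolding col_indep_def by blast
  define s where "s = (\<Sum>j\<in>J. a j * f (r, j))"
  have sum_a: "(\<Sum>j\<in>J. a j * f (i, j)) = s * of_bool (i = r)" for i
    using a[of i] by (auto simp: delete_row_def s_def)
  have "s \<noteq> 0"
  proof
    assume "s = 0"
    then have "a j0 = 0" using col_indepD[OF ind _ j0(1), of a] sum_a by simp
    then show False using j0(2) by simp
  qed
  then have "(\<Sum>j\<in>J. a j / s * f (i, j)) = of_bool (i = r)" for i
    using sum_a[of i] by (simp add: sum_divide_distrib[symmetric])
  then show thesis by (rule that)
qed

text \<open>If every unit vector in the support of column \<open>j0\<close> were a combination of the remaining columns,
  then so would be column \<open>j0\<close>.\<close>

lemma col_indep_delete_row:
  fixes f :: "'r \<times> 'c \<Rightarrow> 'a::field"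
  assumes ind: "col_indep f (insert j0 J)" and j0: "j0 \<notin> J" and fin: "finite (fun_supp f)"
  obtains r where "f (r, j0) \<noteq> 0" "col_indep (delete_row r f) J"
proof -
  have "\<exists>r. f (r, j0) \<noteq> 0 \<and> col_indep (delete_row r f) J"
  proof (rule ccontr)
    assume none: "\<not> ?thesis"
    define R where "R = {r. f (r, j0) \<noteq> 0}"
    have "R \<subseteq> fst ` fun_supp f" by (force simp: R_def)
    then have finR: "finite R" using fin finite_surj by blast
    have indJ: "col_indep f J" by (rule col_indep_subset[OF ind]) blast
    have "\<exists>b. \<forall>i. (\<Sum>j\<in>J. b j * f (i, j)) = of_bool (i = r)" if "r \<in> R" for r
    proof -
      have "\<not> col_indep (delete_row r f) J" using none that by (auto simp: R_def)
      from unit_vector_combination[OF indJ this] show ?thesis by metis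
    qed
    then obtain b where b: "\<And>r i. r \<in> R \<Longrightarrow> (\<Sum>j\<in>J. b r j * f (i, j)) = of_bool (i = r)"
      by metis
    have "f (i, j0) = (\<Sum>j\<in>J. (\<Sum>r\<in>R. f (r, j0) * b r j) * f (i, j))" for i
    proof -
      have "(\<Sum>j\<in>J. (\<Sum>r\<in>R. f (r, j0) * b r j) * f (i, j)) =
          (\<Sum>r\<in>R. f (r, j0) * (\<Sum>j\<in>J. b r j * f (i, j)))"
        unfolding sum_distrib_right sum_distrib_left mult.assoc by (rule sum.swap)
      also have "\<dots> = (\<Sum>r\<in>R. if i = r then f (r, j0) else 0)"
        by (rule sum.cong) (simp_all add: b)
      also have "\<dots> = f (i, j0)" using finR by (simp add: R_def)
      finally show ?thesis ..
    qed
    from not_col_indep_insert_combination[OF col_indep_finite[OF indJ] j0 this] ind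
    show False by blast
  qed
  then show thesis using that by blast
qed

lemma rook_placement_empty [simp]: "rook_placement {}"
  by (simp add: rook_placement_def)

lemma rook_placement_finite: "rook_placement \<mu> \<Longrightarrow> finite \<mu>"
  by (simp add: rook_placement_def)

lemma rook_placement_insert:
  assumes "rook_placement \<mu>" "i \<notin> fst ` \<mu>" "j \<notin> snd ` \<mu>"
  shows "rook_placement (insert (i, j) \<mu>)"
  using assms unfolding rook_placement_def by (auto simp: inj_on_insert)

lemma rook_placement_subset: "rook_placement \<mu> \<Longrightarrow> \<nu> \<subseteq> \<mu> \<Longrightarrow> rook_placement \<nu>"
  by (auto simp: rook_placement_def intro: finite_subset inj_on_subset)

lemma rook_placementD:
  assumes "rook_placement \<mu>" "(i, j) \<in> \<mu>" "(i', j') \<in> \<mu>"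
  shows "i = i' \<longleftrightarrow> j = j'"
  using assms unfolding rook_placement_def inj_on_def by (metis fst_conv snd_conv)

lemma card_rook_placement:
  assumes "rook_placement \<mu>"
  shows "card (fst ` \<mu>) = card \<mu>" "card (snd ` \<mu>) = card \<mu>"
  using assms by (auto simp: rook_placement_def card_image)

lemma rook_placement_induct [consumes 1, case_names empty insert]:
  assumes "rook_placement \<mu>" "P {}"
    and step: "\<And>i j \<mu>. \<lbrakk>rook_placement \<mu>; i \<notin> fst ` \<mu>; j \<notin> snd ` \<mu>; P \<mu>\<rbrakk> \<Longrightarrow> P (insert (i, j) \<mu>)"
  shows "P \<mu>"
  using rook_placement_finite[OF assms(1)] assms(1)
proof (induction \<mu>)
  case empty
  show ?case by (rule assms(2))
next
  case (insert e \<mu>)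
  obtain i j where e: "e = (i, j)" by force
  have "rook_placement \<mu>" "i \<notin> fst ` \<mu>" "j \<notin> snd ` \<mu>"
    using insert.prems insert.hyps(2) unfolding e rook_placement_def by (simp_all add: inj_on_insert)
  then show ?case unfolding e using insert.IH by (intro step)
qed

lemma col_indep_rook_placement:
  fixes f :: "'r \<times> 'c \<Rightarrow> 'a::field"
  assumes "col_indep f J" "finite (fun_supp f)"
  obtains \<mu> where "\<mu> \<subseteq> fun_supp f" "rook_placement \<mu>" "snd ` \<mu> = J"
proof -
  have "\<exists>\<mu>\<subseteq>fun_supp f. rook_placement \<mu> \<and> snd ` \<mu> = J"
    using col_indep_finite[OF assms(1)] assms
  proof (induction J arbitrary: f)
    case empty
    then show ?case by (intro exI[of _ "{}"]) auto
  next
    case (insert j0 J)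
    obtain r where r: "f (r, j0) \<noteq> 0" and ind: "col_indep (delete_row r f) J"
      using col_indep_delete_row[OF insert.prems(1) insert.hyps(2) insert.prems(2)] by blast
    have supp: "fun_supp (delete_row r f) \<subseteq> fun_supp f" "r \<notin> fst ` fun_supp (delete_row r f)"
      by (auto simp: delete_row_def split: if_splits)
    obtain \<mu> where \<mu>: "\<mu> \<subseteq> fun_supp (delete_row r f)" "rook_placement \<mu>" "snd ` \<mu> = J"
      using insert.IH[OF ind finite_subset[OF supp(1) insert.prems(2)]] by blast
    have "rook_placement (insert (r, j0) \<mu>)"
      using \<mu> supp(2) insert.hyps(2) by (intro rook_placement_insert) auto
    then show ?case using r \<mu> supp(1) by (intro exI[of _ "insert (r, j0) \<mu>"]) auto
  qed
  then show thesis using that by blast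
qed

lemma has_rank_rook_placement:
  assumes "has_rank f d" "finite (fun_supp f)"
  obtains \<mu> where "\<mu> \<subseteq> fun_supp f" "rook_placement \<mu>" "card \<mu> = d"
proof -
  obtain J where J: "col_indep f J" "card J = d" using assms(1) by (auto simp: has_rank_def)
  from col_indep_rook_placement[OF J(1) assms(2)]
  show thesis using that J(2) card_rook_placement(2) by metis
qed

lemma has_rank_card_rows:
  assumes "finite (fun_supp f)" "col_indep f J" "card J = card (fst ` fun_supp f)"
  shows "has_rank f (card J)"
  unfolding has_rank_def
proof (intro conjI allI impI)
  show "\<exists>K. col_indep f K \<and> card K = card J" using assms(2) by blast
  fix K assume "col_indep f K"
  from this assms(1) obtain \<mu> where \<mu>: "\<mu> \<subseteq> fun_supp f" "rook_placement \<mu>" "snd ` \<mu> = K"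
    by (rule col_indep_rook_placement)
  then have "card K = card (fst ` \<mu>)" using card_rook_placement[OF \<mu>(2)] by simp
  also have "\<dots> \<le> card (fst ` fun_supp f)" using \<mu>(1) assms(1) by (intro card_mono) auto
  finally show "card K \<le> card J" using assms(3) by simp
qed

lemma has_rank_card_cols_iff:
  assumes fin: "finite (fun_supp f)"
  shows "has_rank f (card (snd ` fun_supp f)) \<longleftrightarrow> col_indep f (snd ` fun_supp f)"
proof
  assume "has_rank f (card (snd ` fun_supp f))"
  then obtain J where J: "col_indep f J" "card J = card (snd ` fun_supp f)"
    by (auto simp: has_rank_def)
  then have "J = snd ` fun_supp f"
    using col_indep_subset_fun_supp[OF J(1)] fin by (intro card_subset_eq) auto
  then show "col_indep f (snd ` fun_supp f)" using J(1) by simp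
next
  assume "col_indep f (snd ` fun_supp f)"
  then show "has_rank f (card (snd ` fun_supp f))"
    unfolding has_rank_def using fin by (auto intro!: card_mono dest: col_indep_subset_fun_supp)
qed

lemma col_indep_singleton: "f (i, j) \<noteq> 0 \<Longrightarrow> col_indep f {j}"
  by (auto simp: col_indep_def)

lemma col_indep_pair:
  assumes "j1 \<noteq> j2" "f (i1, j1) * f (i2, j2) \<noteq> f (i1, j2) * f (i2, j1)"
  shows "col_indep f {j1, j2}"
proof (rule col_indepI)
  fix a j assume a: "\<And>i. (\<Sum>j\<in>{j1, j2}. a j * f (i, j)) = 0" and "j \<in> {j1, j2}"
  let ?D = "f (i1, j1) * f (i2, j2) - f (i1, j2) * f (i2, j1)"
  have row: "a j1 * f (i, j1) + a j2 * f (i, j2) = 0" for i using a[of i] assms(1) by simp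
  have "a j1 * ?D = (a j1 * f (i1, j1) + a j2 * f (i1, j2)) * f (i2, j2)
      - (a j1 * f (i2, j1) + a j2 * f (i2, j2)) * f (i1, j2)"
    and "a j2 * ?D = (a j1 * f (i2, j1) + a j2 * f (i2, j2)) * f (i1, j1)
      - (a j1 * f (i1, j1) + a j2 * f (i1, j2)) * f (i2, j1)"
    by (simp_all add: algebra_simps)
  then have "a j1 * ?D = 0" "a j2 * ?D = 0" by (simp_all only: row mult_zero_left diff_0_right)
  then have "a j1 = 0" "a j2 = 0" using assms(2) by simp_all
  then show "a j = 0" using \<open>j \<in> {j1, j2}\<close> by blast
qed simp

lemma not_col_indep_pair:
  assumes "j1 \<noteq> j2" "f (i1, j1) * f (i2, j2) = f (i1, j2) * f (i2, j1)" "f (i1, j1) \<noteq> 0"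
    and rows: "\<And>i. i \<notin> {i1, i2} \<Longrightarrow> f (i, j1) = 0 \<and> f (i, j2) = 0"
  shows "\<not> col_indep f {j1, j2}"
proof -
  define s where "s = f (i1, j2) / f (i1, j1)"
  have "f (i, j2) = s * f (i, j1)" for i
    using rows[of i] assms(2,3) by (cases "i = i1"; cases "i = i2") (auto simp: s_def field_simps)
  then have "\<not> col_indep f (insert j2 {j1})"
    using assms(1) by (intro not_col_indep_insert_combination[where b = "\<lambda>_. s"]) auto
  then show ?thesis by (simp add: insert_commute)
qed

lemma col_indep_isolated_entry_iff:
  fixes f :: "'r \<times> 'c \<Rightarrow> 'a::field"
  assumes row: "\<And>j. f (r, j) = 0" and col: "\<And>i. f (i, c) = 0" and t: "t \<noteq> 0" and fin: "finite J"
  shows "col_indep (f((r, c) := t)) J \<longleftrightarrow> col_indep f (J - {c})"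
    (is "col_indep ?g J \<longleftrightarrow> _")
proof -
  have combination: "(\<Sum>j\<in>J. a j * ?g (i, j)) =
      (\<Sum>j\<in>J - {c}. a j * f (i, j)) + of_bool (i = r \<and> c \<in> J) * (a c * t)" for a i
  proof -
    have "(\<Sum>j\<in>J. a j * ?g (i, j)) =
        (\<Sum>j\<in>J. a j * f (i, j)) + (\<Sum>j\<in>J. if j = c then of_bool (i = r) * (a c * t) else 0)"
      unfolding sum.distrib[symmetric] by (intro sum.cong) (auto simp: col)
    also have "(\<Sum>j\<in>J. a j * f (i, j)) = (\<Sum>j\<in>J - {c}. a j * f (i, j))"
      using fin by (intro sum.mono_neutral_right) (auto simp: col)
    finally show ?thesis using fin by simp
  qed
  have dependence: "(\<forall>i. (\<Sum>j\<in>J. a j * ?g (i, j)) = 0) \<longleftrightarrow>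
      (\<forall>i. (\<Sum>j\<in>J - {c}. a j * f (i, j)) = 0) \<and> (c \<in> J \<longrightarrow> a c = 0)" for a
    unfolding combination using t row by (auto split: if_splits)
  show ?thesis
  proof
    assume ind: "col_indep ?g J"
    show "col_indep f (J - {c})"
    proof (rule col_indepI)
      fix a j assume a: "\<And>i. (\<Sum>j\<in>J - {c}. a j * f (i, j)) = 0" and j: "j \<in> J - {c}"
      let ?b = "a(c := 0)"
      have "(\<Sum>j\<in>J - {c}. ?b j * f (i, j)) = (\<Sum>j\<in>J - {c}. a j * f (i, j))" for i
        by (rule sum.cong) auto
      then have "\<forall>i. (\<Sum>j\<in>J. ?b j * ?g (i, j)) = 0" unfolding dependence by (simp only: a) simp
      then have "?b j = 0" using col_indepD[OF ind, of ?b j] j by blast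
      then show "a j = 0" using j by simp
    qed (use fin in simp)
  next
    assume "col_indep f (J - {c})"
    then show "col_indep ?g J"
      unfolding col_indep_def dependence using fin by blast
  qed
qed

lemma has_rank_isolated_entry_iff:
  assumes "\<And>j. f (r, j) = 0" and col: "\<And>i. f (i, c) = 0" and t: "t \<noteq> 0"
  shows "has_rank (f((r, c) := t)) (Suc d) \<longleftrightarrow> has_rank f d"
    (is "has_rank ?g _ \<longleftrightarrow> _")
proof -
  have ind_iff: "col_indep ?g J \<longleftrightarrow> col_indep f (J - {c})" if "finite J" for J
    using col_indep_isolated_entry_iff[of f r c t J] assms that by blast
  have insertion: "col_indep ?g (insert c J) \<and> card (insert c J) = Suc (card J)"
    if "col_indep f J" for J
  proof -
    have "c \<notin> J" using col_indep_subset_fun_supp[OF that] col by auto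
    then show ?thesis using that col_indep_finite[OF that] by (simp add: ind_iff)
  qed
  have removal: "col_indep f (J - {c}) \<and> card J \<le> Suc (card (J - {c}))" if "col_indep ?g J" for J
    using that col_indep_finite[OF that] by (auto simp: ind_iff card_Diff_singleton_if)
  show ?thesis
  proof
    assume g: "has_rank ?g (Suc d)"
    then have le: "card J \<le> d" if "col_indep f J" for J
      using insertion[OF that] unfolding has_rank_def by (metis Suc_le_mono)
    obtain J where J: "col_indep ?g J" "card J = Suc d" using g by (auto simp: has_rank_def)
    have "card (J - {c}) = d" using removal[OF J(1)] J(2) le[of "J - {c}"] by simp
    then show "has_rank f d" unfolding has_rank_def using removal[OF J(1)] le by blast
  next
    assume f: "has_rank f d"
    then have "card J \<le> Suc d" if "col_indep ?g J" for J
      using removal[OF that] unfolding has_rank_def by (meson Suc_le_mono le_trans)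
    moreover obtain J where "col_indep f J" "card J = d" using f by (auto simp: has_rank_def)
    ultimately show "has_rank ?g (Suc d)" unfolding has_rank_def using insertion by metis
  qed
qed

section \<open>Counting functions by support and rank\<close>

definition supp_rank_funs :: "('r \<times> 'c) set \<Rightarrow> nat \<Rightarrow> ('r \<times> 'c \<Rightarrow> 'a::field) set" where
  "supp_rank_funs \<sigma> d = {f. fun_supp f = \<sigma> \<and> has_rank f d}"

definition support_weight :: "'a::{field,finite} itself \<Rightarrow> nat \<Rightarrow> ('r \<times> 'c) set \<Rightarrow> int" where
  "support_weight T d \<sigma> =
     int (card (supp_rank_funs \<sigma> d :: ('r \<times> 'c \<Rightarrow> 'a) set)) div (int CARD('a) - 1) ^ d"

text \<open>The index is an integer so that negative ones admit no \<open>\<sigma>\<close>, matching the convention for \<open>r\<^bsub>F,i\<^esub>\<close>.\<close>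

definition placement_with :: "('r \<times> 'c) set \<Rightarrow> int \<Rightarrow> ('r \<times> 'c) set \<Rightarrow> bool" where
  "placement_with \<tau> i \<sigma> \<longleftrightarrow> (\<exists>\<mu>. rook_placement \<mu> \<and> int (card \<mu>) = i \<and>
     fst ` \<tau> \<inter> fst ` \<mu> = {} \<and> snd ` \<tau> \<inter> snd ` \<mu> = {} \<and> \<sigma> = \<tau> \<union> \<mu>)"

lemma card_field_gt_1: "CARD('a::{field,finite}) > 1"
proof -
  have "card {0, 1 :: 'a} \<le> CARD('a)" by (intro card_mono) auto
  then show ?thesis by simp
qed

lemma fun_supp_fun_upd:
  "fun_supp (f(x := t)) = (if t = 0 then fun_supp f - {x} else insert x (fun_supp f))"
  by (auto simp: fun_supp_def)

lemma card_fun_supp_eq: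
  assumes "finite \<sigma>"
  shows "card {f :: 'b \<Rightarrow> 'a::{zero,finite}. fun_supp f = \<sigma>} = (CARD('a) - 1) ^ card \<sigma>"
proof -
  let ?extend = "\<lambda>\<phi> x. if x \<in> \<sigma> then \<phi> x else (0 :: 'a)"
  have "bij_betw (\<lambda>f. restrict f \<sigma>) {f :: 'b \<Rightarrow> 'a. fun_supp f = \<sigma>} (\<sigma> \<rightarrow>\<^sub>E UNIV - {0})"
  proof (rule bij_betw_byWitness[where f' = ?extend])
    show "\<forall>f\<in>{f. fun_supp f = \<sigma>}. ?extend (restrict f \<sigma>) = f" by (auto simp: fun_supp_def)
    show "\<forall>\<phi>\<in>\<sigma> \<rightarrow>\<^sub>E UNIV - {0}. restrict (?extend \<phi>) \<sigma> = \<phi>"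
      by (simp add: restrict_cong)
    show "(\<lambda>f. restrict f \<sigma>) ` {f. fun_supp f = \<sigma>} \<subseteq> \<sigma> \<rightarrow>\<^sub>E UNIV - {0}" by auto
    show "?extend ` (\<sigma> \<rightarrow>\<^sub>E UNIV - {0}) \<subseteq> {f. fun_supp f = \<sigma>}"
      by (auto simp: fun_supp_def split: if_splits)
  qed
  then show ?thesis using assms by (simp add: bij_betw_same_card card_funcsetE card_Diff_subset)
qed

lemma finite_supp_rank_funs:
  assumes "finite \<sigma>"
  shows "finite (supp_rank_funs \<sigma> d :: ('r \<times> 'c \<Rightarrow> 'a::{field,finite}) set)"
proof (rule finite_subset)
  have "CARD('a) - 1 > 0" using card_field_gt_1[where 'a = 'a] by simp
  then show "finite {f :: 'r \<times> 'c \<Rightarrow> 'a. fun_supp f = \<sigma>}"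
    using card_fun_supp_eq[OF assms, where 'a = 'a] by (intro card_ge_0_finite) simp
qed (auto simp: supp_rank_funs_def)

lemma card_supp_rank_funs_constant_rank:
  fixes \<sigma> :: "('r \<times> 'c) set"
  assumes "finite \<sigma>" "\<And>f :: 'r \<times> 'c \<Rightarrow> 'a::{field,finite}. fun_supp f = \<sigma> \<Longrightarrow> has_rank f d"
  shows "card (supp_rank_funs \<sigma> d :: ('r \<times> 'c \<Rightarrow> 'a) set) = (CARD('a) - 1) ^ card \<sigma>"
proof -
  have "(supp_rank_funs \<sigma> d :: ('r \<times> 'c \<Rightarrow> 'a) set) = {f. fun_supp f = \<sigma>}"
    using assms(2) by (auto simp: supp_rank_funs_def)
  then show ?thesis using card_fun_supp_eq[OF assms(1)] by simp
qed

lemma support_weight_constant_rank: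
  fixes \<sigma> :: "('r \<times> 'c) set"
  assumes "finite \<sigma>" "\<And>f :: 'r \<times> 'c \<Rightarrow> 'a::{field,finite}. fun_supp f = \<sigma> \<Longrightarrow> has_rank f d"
    and "card \<sigma> = k + d"
  shows "support_weight TYPE('a) d \<sigma> = (int CARD('a) - 1) ^ k"
  using card_supp_rank_funs_constant_rank[OF assms(1,2)] card_field_gt_1[where 'a = 'a] assms(3)
  by (simp add: support_weight_def power_add)

lemma fun_upd_in_supp_rank_funs_iff:
  assumes "fun_supp f = \<sigma>" "r \<notin> fst ` \<sigma>" "c \<notin> snd ` \<sigma>" "t \<noteq> 0"
  shows "f((r, c) := t) \<in> supp_rank_funs (insert (r, c) \<sigma>) (Suc d) \<longleftrightarrow> f \<in> supp_rank_funs \<sigma> d"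
proof -
  have "f (r, j) = 0" "f (i, c) = 0" for i j using assms(1-3) by force+
  then have "has_rank (f((r, c) := t)) (Suc d) \<longleftrightarrow> has_rank f d"
    using assms(4) by (intro has_rank_isolated_entry_iff)
  then show ?thesis using assms(1,4) by (simp add: supp_rank_funs_def fun_supp_fun_upd)
qed

lemma card_supp_rank_funs_isolated_edge:
  fixes \<sigma> :: "('r \<times> 'c) set"
  assumes r: "r \<notin> fst ` \<sigma>" and c: "c \<notin> snd ` \<sigma>"
  shows "card (supp_rank_funs (insert (r, c) \<sigma>) (Suc d) :: ('r \<times> 'c \<Rightarrow> 'a::{field,finite}) set) =
    (CARD('a) - 1) * card (supp_rank_funs \<sigma> d :: ('r \<times> 'c \<Rightarrow> 'a) set)"
proof -
  let ?S = "supp_rank_funs \<sigma> d :: ('r \<times> 'c \<Rightarrow> 'a) set"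
    and ?S' = "supp_rank_funs (insert (r, c) \<sigma>) (Suc d) :: ('r \<times> 'c \<Rightarrow> 'a) set"
    and ?U = "UNIV - {0 :: 'a}"
    and ?extend = "\<lambda>(t, f). f((r, c) := t) :: 'r \<times> 'c \<Rightarrow> 'a"
  have supp: "fun_supp f = \<sigma>" "f (r, c) = 0" if "f \<in> ?S" for f
    using that r by (force simp: supp_rank_funs_def)+
  have "bij_betw ?extend (?U \<times> ?S) ?S'"
  proof (rule bij_betw_byWitness[where f' = "\<lambda>g. (g (r, c), g((r, c) := 0))"])
    show "\<forall>x\<in>?U \<times> ?S. (?extend x (r, c), (?extend x)((r, c) := 0)) = x"
      using supp(2) by (simp add: fun_upd_idem split_beta)
    show "?extend ` (?U \<times> ?S) \<subseteq> ?S'"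
      using fun_upd_in_supp_rank_funs_iff[OF supp(1) r c] by auto
    show "(\<lambda>g. (g (r, c), g((r, c) := 0))) ` ?S' \<subseteq> ?U \<times> ?S"
    proof (intro image_subsetI SigmaI)
      fix g assume g: "g \<in> ?S'"
      then have supp_g: "fun_supp g = insert (r, c) \<sigma>" by (simp add: supp_rank_funs_def)
      then show nz: "g (r, c) \<in> ?U" by auto
      have "fun_supp (g((r, c) := 0)) = \<sigma>" using supp_g r by (force simp: fun_supp_fun_upd)
      from fun_upd_in_supp_rank_funs_iff[OF this r c, of "g (r, c)"] show "g((r, c) := 0) \<in> ?S"
        using g nz by simp
    qed
  qed auto
  then have "card ?S' = card (?U \<times> ?S)" by (rule bij_betw_same_card[symmetric])
  then show ?thesis by (simp add: card_cartesian_product card_Diff_subset)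
qed

lemma support_weight_placement_with:
  fixes \<sigma> :: "('r \<times> 'c) set"
  assumes "placement_with \<tau> (int d - int k) \<sigma>"
  shows "support_weight TYPE('a::{field,finite}) d \<sigma> = support_weight TYPE('a) k \<tau>"
proof -
  obtain \<mu> where \<mu>: "rook_placement \<mu>" "d = card \<mu> + k"
    "fst ` \<tau> \<inter> fst ` \<mu> = {}" "snd ` \<tau> \<inter> snd ` \<mu> = {}" "\<sigma> = \<tau> \<union> \<mu>"
    using assms by (auto simp: placement_with_def)
  have "card (supp_rank_funs (\<tau> \<union> \<mu>) (card \<mu> + k) :: ('r \<times> 'c \<Rightarrow> 'a) set) =
      (CARD('a) - 1) ^ card \<mu> * card (supp_rank_funs \<tau> k :: ('r \<times> 'c \<Rightarrow> 'a) set)"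
    using \<mu>(1,3,4)
  proof (induction rule: rook_placement_induct)
    case empty
    show ?case by simp
  next
    case (insert i j \<mu>)
    have "(i, j) \<notin> \<mu>" using insert.hyps(2) by force
    moreover have "i \<notin> fst ` (\<tau> \<union> \<mu>)" "j \<notin> snd ` (\<tau> \<union> \<mu>)" using insert.hyps insert.prems by auto
    ultimately show ?case
      using insert.IH insert.prems rook_placement_finite[OF insert.hyps(1)]
        card_supp_rank_funs_isolated_edge[of i "\<tau> \<union> \<mu>" j "card \<mu> + k", where 'a = 'a]
      by simp
  qed
  then show ?thesis
    using card_field_gt_1[where 'a = 'a] \<mu>(2,5)
    by (simp add: support_weight_def power_add)
qed

section \<open>The exceptional supports\<close>

definition is_copy :: "('r, 'c) bigraph \<Rightarrow> ('s \<times> 'd) set \<Rightarrow> bool" where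
  "is_copy G \<tau> \<longleftrightarrow> (\<exists>f g. inj_on f (row_verts G) \<and> inj_on g (col_verts G) \<and>
     \<tau> = map_prod f g ` edges G)"

definition graph_placement :: "('r, 'c) bigraph \<Rightarrow> int \<Rightarrow> ('s \<times> 'd) set \<Rightarrow> bool" where
  "graph_placement G i \<sigma> \<longleftrightarrow> (\<exists>\<tau>. is_copy G \<tau> \<and> placement_with \<tau> i \<sigma>)"

lemma inj_on_one_two_iff: "inj_on f {1, 2 :: nat} \<longleftrightarrow> f 1 \<noteq> f 2"
  by (auto simp: inj_on_def)

lemma is_copy_ZG_iff:
  "is_copy ZG \<tau> \<longleftrightarrow> (\<exists>r1 r2 c1 c2. r1 \<noteq> r2 \<and> c1 \<noteq> c2 \<and> \<tau> = {(r1, c1), (r1, c2), (r2, c2)})"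
proof
  assume "is_copy ZG \<tau>"
  then show "\<exists>r1 r2 c1 c2. r1 \<noteq> r2 \<and> c1 \<noteq> c2 \<and> \<tau> = {(r1, c1), (r1, c2), (r2, c2)}"
    unfolding is_copy_def ZG_def bigraph.sel inj_on_one_two_iff by auto
next
  assume "\<exists>r1 r2 c1 c2. r1 \<noteq> r2 \<and> c1 \<noteq> c2 \<and> \<tau> = {(r1, c1), (r1, c2), (r2, c2)}"
  then obtain r1 r2 c1 c2 where "r1 \<noteq> r2" "c1 \<noteq> c2" "\<tau> = {(r1, c1), (r1, c2), (r2, c2)}" by blast
  then show "is_copy ZG \<tau>"
    unfolding is_copy_def ZG_def bigraph.sel inj_on_one_two_iff
    by (intro exI[of _ "\<lambda>k. if k = 1 then r1 else r2"] exI[of _ "\<lambda>k. if k = 1 then c1 else c2"]) auto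
qed

lemma is_copy_SG_iff:
  "is_copy SG \<tau> \<longleftrightarrow> (\<exists>r1 r2 c1 c2. r1 \<noteq> r2 \<and> c1 \<noteq> c2 \<and>
     \<tau> = {(r1, c1), (r1, c2), (r2, c1), (r2, c2)})"
proof
  assume "is_copy SG \<tau>"
  then show "\<exists>r1 r2 c1 c2. r1 \<noteq> r2 \<and> c1 \<noteq> c2 \<and> \<tau> = {(r1, c1), (r1, c2), (r2, c1), (r2, c2)}"
    unfolding is_copy_def SG_def bigraph.sel inj_on_one_two_iff by force
next
  assume "\<exists>r1 r2 c1 c2. r1 \<noteq> r2 \<and> c1 \<noteq> c2 \<and> \<tau> = {(r1, c1), (r1, c2), (r2, c1), (r2, c2)}"
  then obtain r1 r2 c1 c2 where "r1 \<noteq> r2" "c1 \<noteq> c2" "\<tau> = {(r1, c1), (r1, c2), (r2, c1), (r2, c2)}"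
    by blast
  then show "is_copy SG \<tau>"
    unfolding is_copy_def SG_def bigraph.sel inj_on_one_two_iff
    by (intro exI[of _ "\<lambda>k. if k = 1 then r1 else r2"] exI[of _ "\<lambda>k. if k = 1 then c1 else c2"]) auto
qed

lemma is_copy_WRG_iff: "is_copy WRG \<tau> \<longleftrightarrow> (\<exists>r1 r2 c. r1 \<noteq> r2 \<and> \<tau> = {(r1, c), (r2, c)})"
proof
  assume "is_copy WRG \<tau>"
  then show "\<exists>r1 r2 c. r1 \<noteq> r2 \<and> \<tau> = {(r1, c), (r2, c)}"
    unfolding is_copy_def WRG_def bigraph.sel inj_on_one_two_iff by auto
next
  assume "\<exists>r1 r2 c. r1 \<noteq> r2 \<and> \<tau> = {(r1, c), (r2, c)}"
  then obtain r1 r2 c where "r1 \<noteq> r2" "\<tau> = {(r1, c), (r2, c)}" by blast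
  then show "is_copy WRG \<tau>"
    unfolding is_copy_def WRG_def bigraph.sel inj_on_one_two_iff
    by (intro exI[of _ "\<lambda>k. if k = 1 then r1 else r2"] exI[of _ "\<lambda>_. c"]) auto
qed

lemma is_copy_WCG_iff: "is_copy WCG \<tau> \<longleftrightarrow> (\<exists>r c1 c2. c1 \<noteq> c2 \<and> \<tau> = {(r, c1), (r, c2)})"
proof
  assume "is_copy WCG \<tau>"
  then show "\<exists>r c1 c2. c1 \<noteq> c2 \<and> \<tau> = {(r, c1), (r, c2)}"
    unfolding is_copy_def WCG_def bigraph.sel inj_on_one_two_iff by auto
next
  assume "\<exists>r c1 c2. c1 \<noteq> c2 \<and> \<tau> = {(r, c1), (r, c2)}"
  then obtain r c1 c2 where "c1 \<noteq> c2" "\<tau> = {(r, c1), (r, c2)}" by blast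
  then show "is_copy WCG \<tau>"
    unfolding is_copy_def WCG_def bigraph.sel inj_on_one_two_iff
    by (intro exI[of _ "\<lambda>_. r"] exI[of _ "\<lambda>k. if k = 1 then c1 else c2"]) auto
qed

definition profile :: "('r \<times> 'c) set \<Rightarrow> int \<times> int \<times> int" where
  "profile \<sigma> = (int (card \<sigma>), int (card (fst ` \<sigma>)), int (card (snd ` \<sigma>)))"

lemma profile_placement_with:
  assumes "placement_with \<tau> i \<sigma>" "finite \<tau>"
  shows "profile \<sigma> = profile \<tau> + (i, i, i)"
proof -
  obtain \<mu> where \<mu>: "rook_placement \<mu>" "int (card \<mu>) = i"
    "fst ` \<tau> \<inter> fst ` \<mu> = {}" "snd ` \<tau> \<inter> snd ` \<mu> = {}" "\<sigma> = \<tau> \<union> \<mu>"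
    using assms(1) by (auto simp: placement_with_def)
  have "\<tau> \<inter> \<mu> = {}" using \<mu>(3) by force
  then show ?thesis
    using \<mu>(2-4) assms(2) rook_placement_finite[OF \<mu>(1)] card_rook_placement[OF \<mu>(1)]
    by (simp add: profile_def \<mu>(5) image_Un card_Un_disjoint)
qed

lemma profile_rook_placement:
  "rook_placement \<mu> \<Longrightarrow> profile \<mu> = (int (card \<mu>), int (card \<mu>), int (card \<mu>))"
  by (simp add: profile_def card_rook_placement)

lemma profile_graph_placement:
  assumes "graph_placement G i \<sigma>" "finite (edges G)"
    and edges: "edges G \<subseteq> row_verts G \<times> col_verts G"
  shows "profile \<sigma> = profile (edges G) + (i, i, i)"
proof -
  obtain f g where f: "inj_on f (row_verts G)" and g: "inj_on g (col_verts G)"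
    and pl: "placement_with (map_prod f g ` edges G) i \<sigma>"
    using assms(1) by (auto simp: graph_placement_def is_copy_def)
  let ?E = "edges G" and ?fg = "map_prod f g"
  have "inj_on f (fst ` ?E)" "inj_on g (snd ` ?E)" "inj_on ?fg ?E"
    using edges f g map_prod_inj_on[OF f g] by (auto elim!: inj_on_subset)
  moreover have "fst ` ?fg ` ?E = f ` fst ` ?E" "snd ` ?fg ` ?E = g ` snd ` ?E"
    by (simp_all add: image_image)
  ultimately have "profile (?fg ` ?E) = profile ?E" by (simp add: profile_def card_image)
  then show ?thesis using profile_placement_with[OF pl] assms(2) by simp
qed

lemma profile_exceptional:
  shows "graph_placement ZG (i - 2) \<sigma> \<Longrightarrow> profile \<sigma> = (i + 1, i, i)"
    and "graph_placement SG (i - 2) \<sigma> \<Longrightarrow> profile \<sigma> = (i + 2, i, i)"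
    and "graph_placement WRG (i - 1) \<sigma> \<Longrightarrow> profile \<sigma> = (i + 1, i + 1, i)"
    and "graph_placement WCG (i - 1) \<sigma> \<Longrightarrow> profile \<sigma> = (i + 1, i, i + 1)"
  by (drule profile_graph_placement; auto simp: profile_def ZG_def SG_def WRG_def WCG_def insert_commute)+

lemma has_rank_rook_placement_support:
  assumes "rook_placement \<mu>" and f: "fun_supp f = \<mu>"
  shows "has_rank f (card \<mu>)"
proof -
  have fin: "finite \<mu>" by (rule rook_placement_finite[OF assms(1)])
  have "col_indep f (snd ` \<mu>)"
  proof (rule col_indepI)
    fix a j assume a: "\<And>i. (\<Sum>j\<in>snd ` \<mu>. a j * f (i, j)) = 0" and "j \<in> snd ` \<mu>"
    then obtain i where ij: "(i, j) \<in> \<mu>" by force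
    have "f (i, j') = 0" if "j' \<noteq> j" for j'
    proof -
      have "(i, j') \<notin> \<mu>" using rook_placementD[OF assms(1) ij, of i j'] that by blast
      then show ?thesis using f by auto
    qed
    then have "(\<Sum>j'\<in>snd ` \<mu>. a j' * f (i, j')) = (\<Sum>j'\<in>{j}. a j' * f (i, j'))"
      using ij fin by (intro sum.mono_neutral_right) force+
    then have "a j * f (i, j) = 0" using a[of i] by simp
    then show "a j = 0" using ij f by auto
  qed (use fin in simp)
  then show ?thesis
    using has_rank_card_cols_iff[of f] card_rook_placement(2)[OF assms(1)] fin by (simp add: f)
qed

lemma support_weight_rook_placement:
  assumes "rook_placement (\<sigma> :: ('r \<times> 'c) set)"
  shows "support_weight TYPE('a::{field,finite}) (card \<sigma>) \<sigma> = 1"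
  using support_weight_constant_rank[OF rook_placement_finite[OF assms]
      has_rank_rook_placement_support[OF assms], of 0, where 'a = 'a] by simp

lemma support_weight_ZG:
  assumes "is_copy ZG (\<tau> :: ('r \<times> 'c) set)"
  shows "support_weight TYPE('a::{field,finite}) 2 \<tau> = int CARD('a) - 1"
proof -
  obtain r1 r2 c1 c2 where ne: "r1 \<noteq> r2" "c1 \<noteq> c2" and \<tau>: "\<tau> = {(r1, c1), (r1, c2), (r2, c2)}"
    using assms by (auto simp: is_copy_ZG_iff)
  have "has_rank f 2" if f: "fun_supp f = \<tau>" for f :: "'r \<times> 'c \<Rightarrow> 'a"
  proof -
    have "f (r1, c1) \<noteq> 0" "f (r2, c2) \<noteq> 0" "f (r2, c1) = 0"
      using f ne unfolding \<tau> set_eq_iff mem_fun_supp by auto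
    then have "col_indep f {c1, c2}"
      using ne by (intro col_indep_pair[where ?i1.0 = r1 and ?i2.0 = r2]) auto
    then show ?thesis using has_rank_card_cols_iff[of f] ne by (simp add: f \<tau> numeral_2_eq_2)
  qed
  then show ?thesis using support_weight_constant_rank[of \<tau> 2 1, where 'a = 'a] ne by (simp add: \<tau>)
qed

lemma support_weight_WRG:
  assumes "is_copy WRG (\<tau> :: ('r \<times> 'c) set)"
  shows "support_weight TYPE('a::{field,finite}) 1 \<tau> = int CARD('a) - 1"
proof -
  obtain r1 r2 c where ne: "r1 \<noteq> r2" and \<tau>: "\<tau> = {(r1, c), (r2, c)}"
    using assms by (auto simp: is_copy_WRG_iff)
  have "has_rank f 1" if f: "fun_supp f = \<tau>" for f :: "'r \<times> 'c \<Rightarrow> 'a"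
  proof -
    have "f (r1, c) \<noteq> 0" using f unfolding \<tau> set_eq_iff mem_fun_supp by auto
    then show ?thesis using has_rank_card_cols_iff[of f] col_indep_singleton[of f] by (simp add: f \<tau>)
  qed
  then show ?thesis using support_weight_constant_rank[of \<tau> 1 1, where 'a = 'a] ne by (simp add: \<tau>)
qed

lemma support_weight_WCG:
  assumes "is_copy WCG (\<tau> :: ('r \<times> 'c) set)"
  shows "support_weight TYPE('a::{field,finite}) 1 \<tau> = int CARD('a) - 1"
proof -
  obtain r c1 c2 where ne: "c1 \<noteq> c2" and \<tau>: "\<tau> = {(r, c1), (r, c2)}"
    using assms by (auto simp: is_copy_WCG_iff)
  have "has_rank f 1" if f: "fun_supp f = \<tau>" for f :: "'r \<times> 'c \<Rightarrow> 'a"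
  proof -
    have "f (r, c1) \<noteq> 0" using f unfolding \<tau> set_eq_iff mem_fun_supp by auto
    then show ?thesis using has_rank_card_rows[of f "{c1}"] col_indep_singleton[of f] by (simp add: f \<tau>)
  qed
  then show ?thesis using support_weight_constant_rank[of \<tau> 1 1, where 'a = 'a] ne by (simp add: \<tau>)
qed

lemma card_singular_square_funs:
  assumes "r1 \<noteq> r2" "c1 \<noteq> c2"
  defines "\<tau> \<equiv> {(r1, c1), (r1, c2), (r2, c1), (r2, c2)}"
  shows "card {f :: 'r \<times> 'c \<Rightarrow> 'a::{field,finite}. fun_supp f = \<tau> \<and>
    f (r1, c1) * f (r2, c2) = f (r1, c2) * f (r2, c1)} = (CARD('a) - 1) ^ 3"
    (is "card ?S = _")
proof -
  let ?T = "{g :: 'r \<times> 'c \<Rightarrow> 'a. fun_supp g = {(r1, c1), (r1, c2), (r2, c1)}}"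
  let ?extend = "\<lambda>g. g((r2, c2) := g (r1, c2) * g (r2, c1) / g (r1, c1)) :: 'r \<times> 'c \<Rightarrow> 'a"
  have supp: "\<tau> - {(r2, c2)} = {(r1, c1), (r1, c2), (r2, c1)}"
    "insert (r2, c2) {(r1, c1), (r1, c2), (r2, c1)} = \<tau>" using assms by (auto simp: \<tau>_def)
  have T: "g (r1, c1) \<noteq> 0" "g (r1, c2) \<noteq> 0" "g (r2, c1) \<noteq> 0" "g (r2, c2) = 0" if "g \<in> ?T" for g
    using that assms(1,2) unfolding set_eq_iff by auto
  have "bij_betw (\<lambda>f. f((r2, c2) := 0)) ?S ?T"
  proof (rule bij_betw_byWitness[where f' = ?extend])
    show "\<forall>f\<in>?S. ?extend (f((r2, c2) := 0)) = f"
    proof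
      fix f assume f: "f \<in> ?S"
      then have "f (r1, c1) \<noteq> 0" unfolding \<tau>_def set_eq_iff by auto
      then have "f (r1, c2) * f (r2, c1) / f (r1, c1) = f (r2, c2)" using f by (simp add: field_simps)
      then show "?extend (f((r2, c2) := 0)) = f" using assms(1,2) by simp
    qed
    show "\<forall>g\<in>?T. (?extend g)((r2, c2) := 0) = g" using T(4) by (simp add: fun_upd_idem)
    show "(\<lambda>f. f((r2, c2) := 0)) ` ?S \<subseteq> ?T" 
      by (rule image_subsetI) (simp add: fun_supp_fun_upd supp(1))
    show "?extend ` ?T \<subseteq> ?S"
    proof (intro image_subsetI CollectI conjI)
      fix g assume g: "g \<in> ?T"
      show "fun_supp (?extend g) = \<tau>" using g T[OF g] supp(2) by (simp add: fun_supp_fun_upd)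
      show "?extend g (r1, c1) * ?extend g (r2, c2) = ?extend g (r1, c2) * ?extend g (r2, c1)"
        using T(1)[OF g] assms(1,2) by simp
    qed
  qed
  then show ?thesis
    using assms(1,2) by (simp add: bij_betw_same_card card_fun_supp_eq power3_eq_cube mult.assoc)
qed

lemma support_weight_SG:
  assumes "is_copy SG (\<tau> :: ('r \<times> 'c) set)"
  shows "support_weight TYPE('a::{field,finite}) 2 \<tau> = (int CARD('a) - 1)\<^sup>2 - (int CARD('a) - 1)"
proof -
  obtain r1 r2 c1 c2 where ne: "r1 \<noteq> r2" "c1 \<noteq> c2"
    and \<tau>: "\<tau> = {(r1, c1), (r1, c2), (r2, c1), (r2, c2)}"
    using assms by (auto simp: is_copy_SG_iff)
  let ?S = "{f :: 'r \<times> 'c \<Rightarrow> 'a. fun_supp f = \<tau>}"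
  let ?singular = "{f \<in> ?S. f (r1, c1) * f (r2, c2) = f (r1, c2) * f (r2, c1)}"
  have "has_rank f 2 \<longleftrightarrow> f (r1, c1) * f (r2, c2) \<noteq> f (r1, c2) * f (r2, c1)" if "f \<in> ?S" for f
  proof -
    have f: "fun_supp f = \<tau>" using that by simp
    have cols: "snd ` fun_supp f = {c1, c2}" by (auto simp: f \<tau>)
    have "has_rank f 2 \<longleftrightarrow> col_indep f {c1, c2}"
      using has_rank_card_cols_iff[of f] ne unfolding cols by (simp add: f \<tau> numeral_2_eq_2)
    moreover have "f (r1, c1) \<noteq> 0" "\<And>r. r \<notin> {r1, r2} \<Longrightarrow> f (r, c1) = 0 \<and> f (r, c2) = 0"
      using f unfolding \<tau> set_eq_iff mem_fun_supp by auto
    ultimately show ?thesis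
      using col_indep_pair[of c1 c2 f r1 r2] not_col_indep_pair[of c1 c2 f r1 r2] ne by blast
  qed
  then have "supp_rank_funs \<tau> 2 = ?S - ?singular" by (auto simp: supp_rank_funs_def)
  moreover have singular: "card ?singular = (CARD('a) - 1) ^ 3"
    using card_singular_square_funs[OF ne, where 'a = 'a] by (simp add: \<tau>)
  moreover have "finite ?singular"
    using singular card_field_gt_1[where 'a = 'a] by (intro card_ge_0_finite) simp
  moreover have "card \<tau> = 4" "finite \<tau>" using ne by (simp_all add: \<tau>)
  then have "card ?S = (CARD('a) - 1) ^ 4" by (simp add: card_fun_supp_eq)
  ultimately have "card (supp_rank_funs \<tau> 2 :: ('r \<times> 'c \<Rightarrow> 'a) set) =
      (CARD('a) - 1) ^ 4 - (CARD('a) - 1) ^ 3"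
    using card_Diff_subset[of ?singular ?S] by (simp add: subset_eq)
  then have "int (card (supp_rank_funs \<tau> 2 :: ('r \<times> 'c \<Rightarrow> 'a) set)) =
      (int CARD('a) - 1) ^ 4 - (int CARD('a) - 1) ^ 3"
    using card_field_gt_1[where 'a = 'a] by (simp add: power_increasing)
  also have "\<dots> = (int CARD('a) - 1)\<^sup>2 * ((int CARD('a) - 1)\<^sup>2 - (int CARD('a) - 1))"
    by (simp add: algebra_simps eval_nat_numeral)
  finally show ?thesis using card_field_gt_1[where 'a = 'a] by (simp add: support_weight_def)
qed

lemma support_weight_graph_placement:
  assumes "graph_placement G (int d - int k) \<sigma>"
    and "\<And>\<tau> :: ('r \<times> 'c) set. is_copy G \<tau> \<Longrightarrow> support_weight TYPE('a::{field,finite}) k \<tau> = w"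
  shows "support_weight TYPE('a) d (\<sigma> :: ('r \<times> 'c) set) = w"
  using assms support_weight_placement_with unfolding graph_placement_def by metis

lemma support_weight_exceptional:
  defines "q \<equiv> int CARD('a::{field,finite})"
  shows "graph_placement ZG (int d - 2) \<sigma> \<Longrightarrow> support_weight TYPE('a) d \<sigma> = q - 1"
    and "graph_placement SG (int d - 2) \<sigma> \<Longrightarrow> support_weight TYPE('a) d \<sigma> = (q - 1)\<^sup>2 - (q - 1)"
    and "graph_placement WRG (int d - 1) \<sigma> \<Longrightarrow> support_weight TYPE('a) d \<sigma> = q - 1"
    and "graph_placement WCG (int d - 1) \<sigma> \<Longrightarrow> support_weight TYPE('a) d \<sigma> = q - 1"
  using support_weight_graph_placement[of ZG d 2 \<sigma>, OF _ support_weight_ZG]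
    support_weight_graph_placement[of SG d 2 \<sigma>, OF _ support_weight_SG]
    support_weight_graph_placement[of WRG d 1 \<sigma>, OF _ support_weight_WRG]
    support_weight_graph_placement[of WCG d 1 \<sigma>, OF _ support_weight_WCG]
  by (simp_all add: q_def)

section \<open>The torus action\<close>

text \<open>A finite \<open>F\<close> satisfies this for a field with more than two elements iff it is a forest.\<close>

definition torus_transitive :: "'a::field itself \<Rightarrow> ('r \<times> 'c) set \<Rightarrow> bool" where
  "torus_transitive T F \<longleftrightarrow> (\<forall>\<phi> :: 'r \<times> 'c \<Rightarrow> 'a. (\<forall>e\<in>F. \<phi> e \<noteq> 0) \<longrightarrow>
     (\<exists>x y. (\<forall>r. x r \<noteq> 0) \<and> (\<forall>c. y c \<noteq> 0) \<and> (\<forall>r c. (r, c) \<in> F \<longrightarrow> x r * y c = \<phi> (r, c))))"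

definition scale :: "('r \<Rightarrow> 'a) \<Rightarrow> ('c \<Rightarrow> 'a) \<Rightarrow> ('r \<times> 'c \<Rightarrow> 'a::field) \<Rightarrow> 'r \<times> 'c \<Rightarrow> 'a" where
  "scale x y f = (\<lambda>(r, c). x r * y c * f (r, c))"

lemma fun_supp_scale:
  assumes "\<forall>r. x r \<noteq> 0" "\<forall>c. y c \<noteq> 0"
  shows "fun_supp (scale x y f) = fun_supp f"
  using assms by (auto simp: scale_def)

lemma scale_inverse:
  assumes "\<forall>r. x r \<noteq> 0" "\<forall>c. y c \<noteq> 0"
  shows "scale x y (scale (inverse \<circ> x) (inverse \<circ> y) f) = f"
    and "scale (inverse \<circ> x) (inverse \<circ> y) (scale x y f) = f"
  using assms by (auto simp: scale_def field_simps)

lemma col_indep_scale: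
  assumes x: "\<forall>r. x r \<noteq> 0" and y: "\<forall>c. y c \<noteq> 0" and ind: "col_indep f J"
  shows "col_indep (scale x y f) J"
proof (rule col_indepI)
  fix a j assume a: "\<And>i. (\<Sum>j\<in>J. a j * scale x y f (i, j)) = 0" and j: "j \<in> J"
  have "(\<Sum>j\<in>J. (a j * y j) * f (i, j)) = 0" for i
  proof -
    have "x i * (\<Sum>j\<in>J. (a j * y j) * f (i, j)) = (\<Sum>j\<in>J. a j * scale x y f (i, j))"
      by (simp add: sum_distrib_left scale_def algebra_simps)
    then show ?thesis using a x by simp
  qed
  then have "a j * y j = 0" by (rule col_indepD[OF ind]) (rule j)
  then show "a j = 0" using y by simp
qed (rule col_indep_finite[OF ind])

lemma has_rank_scale:
  assumes "\<forall>r. x r \<noteq> 0" "\<forall>c. y c \<noteq> 0"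
  shows "has_rank (scale x y f) d \<longleftrightarrow> has_rank f d"
proof -
  have "col_indep (scale x y f) J \<longleftrightarrow> col_indep f J" for J
    using col_indep_scale[OF assms, of f J]
      col_indep_scale[of "inverse \<circ> x" "inverse \<circ> y" "scale x y f" J] assms
    by (auto simp: scale_inverse(2))
  then show ?thesis by (simp add: has_rank_def)
qed

lemma scale_in_supp_rank_funs_iff:
  assumes "\<forall>r. x r \<noteq> 0" "\<forall>c. y c \<noteq> 0"
  shows "scale x y f \<in> supp_rank_funs \<sigma> d \<longleftrightarrow> f \<in> supp_rank_funs \<sigma> d"
  by (simp add: supp_rank_funs_def has_rank_scale[OF assms] fun_supp_scale[OF assms])

lemma card_supp_rank_funs_restrict:
  fixes \<sigma> :: "('r \<times> 'c) set" and \<phi> :: "'r \<times> 'c \<Rightarrow> 'a::field"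
  assumes "torus_transitive TYPE('a) F" and \<phi>: "\<phi> \<in> F \<rightarrow>\<^sub>E UNIV - {0}"
  shows "card {f \<in> supp_rank_funs \<sigma> d. restrict f F = \<phi>} =
    card {f \<in> supp_rank_funs \<sigma> d. restrict f F = (\<lambda>e\<in>F. 1 :: 'a)}"
    (is "card ?S\<phi> = card ?S1")
proof -
  obtain x y where x: "\<forall>r. x r \<noteq> 0" and y: "\<forall>c. y c \<noteq> 0"
    and xy: "\<And>r c. (r, c) \<in> F \<Longrightarrow> x r * y c = \<phi> (r, c)"
    using assms unfolding torus_transitive_def PiE_iff by blast
  have "(restrict (scale x y f) F = \<phi>) \<longleftrightarrow> (restrict f F = (\<lambda>e\<in>F. 1))" for f
  proof -
    have "(restrict (scale x y f) F = \<phi>) \<longleftrightarrow> (\<forall>e\<in>F. scale x y f e = \<phi> e)"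
      using \<phi> by (auto simp: fun_eq_iff restrict_def PiE_iff extensional_def)
    also have "\<dots> \<longleftrightarrow> (\<forall>e\<in>F. f e = 1)"
      using xy \<phi> by (intro ball_cong) (auto simp: scale_def PiE_iff)
    also have "\<dots> \<longleftrightarrow> (restrict f F = (\<lambda>e\<in>F. 1))"
      by (auto simp: fun_eq_iff restrict_def)
    finally show ?thesis .
  qed
  then have scale_iff: "scale x y f \<in> ?S\<phi> \<longleftrightarrow> f \<in> ?S1" for f
    by (simp add: scale_in_supp_rank_funs_iff[OF x y])
  have "bij_betw (scale x y) ?S1 ?S\<phi>"
  proof (rule bij_betw_byWitness[where f' = "scale (inverse \<circ> x) (inverse \<circ> y)"])
    show "scale x y ` ?S1 \<subseteq> ?S\<phi>" using scale_iff by blast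
    show "scale (inverse \<circ> x) (inverse \<circ> y) ` ?S\<phi> \<subseteq> ?S1"
    proof (rule image_subsetI)
      fix f assume "f \<in> ?S\<phi>"
      then show "scale (inverse \<circ> x) (inverse \<circ> y) f \<in> ?S1"
        using scale_iff[of "scale (inverse \<circ> x) (inverse \<circ> y) f"] scale_inverse(1)[OF x y] by simp
    qed
  qed (simp_all add: scale_inverse[OF x y])
  then show ?thesis by (rule bij_betw_same_card[symmetric])
qed

lemma torus_transitive_dvd_card:
  fixes \<sigma> :: "('r \<times> 'c) set"
  assumes transitive: "torus_transitive TYPE('a::{field,finite}) F" and F: "F \<subseteq> \<sigma>" and fin: "finite \<sigma>"
  shows "(CARD('a) - 1) ^ card F dvd card (supp_rank_funs \<sigma> d :: ('r \<times> 'c \<Rightarrow> 'a) set)"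
proof -
  let ?S = "supp_rank_funs \<sigma> d :: ('r \<times> 'c \<Rightarrow> 'a) set" and ?P = "F \<rightarrow>\<^sub>E (UNIV - {0 :: 'a})"
  have finF: "finite F" using F fin by (rule finite_subset)
  have "(\<lambda>f. restrict f F) ` ?S \<subseteq> ?P" using F by (auto simp: supp_rank_funs_def)
  moreover have "finite ?S" "finite ?P"
    using finite_supp_rank_funs[OF fin] finF by (auto intro: finite_PiE)
  ultimately have "card ?S = (\<Sum>\<phi>\<in>?P. card {f \<in> ?S. restrict f F = \<phi>})"
    using sum.group[of ?S ?P "\<lambda>f. restrict f F" "\<lambda>_. 1 :: nat"] by simp
  also have "\<dots> = (\<Sum>\<phi>\<in>?P. card {f \<in> ?S. restrict f F = (\<lambda>e\<in>F. 1)})"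
    by (rule sum.cong[OF refl card_supp_rank_funs_restrict[OF transitive]])
  also have "\<dots> = card ?P * card {f \<in> ?S. restrict f F = (\<lambda>e\<in>F. 1)}" by simp
  also have "card ?P = (CARD('a) - 1) ^ card F"
    using finF by (simp add: card_funcsetE card_Diff_subset)
  finally show ?thesis by simp
qed

lemma torus_transitive_dvd_support_weight:
  fixes \<sigma> :: "('r \<times> 'c) set"
  assumes "torus_transitive TYPE('a::{field,finite}) F" "F \<subseteq> \<sigma>" "finite \<sigma>" "card F = d + k"
  shows "(int CARD('a) - 1) ^ k dvd support_weight TYPE('a) d \<sigma>"
proof -
  have "int ((CARD('a) - 1) ^ (d + k)) dvd int (card (supp_rank_funs \<sigma> d :: ('r \<times> 'c \<Rightarrow> 'a) set))"
    using torus_transitive_dvd_card[OF assms(1-3)] assms(4) by (simp only: of_nat_dvd_iff)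
  then show ?thesis
    using card_field_gt_1[where 'a = 'a]
    by (auto simp: support_weight_def power_add mult.assoc dvd_def)
qed

lemma torus_transitive_empty: "torus_transitive T {}"
  unfolding torus_transitive_def by (auto intro!: exI[of _ "\<lambda>_. 1"])

text \<open>The vertex set \<open>R \<union> C\<close> is a cut crossed by the new edge but by no edge of \<open>F\<close>: scaling its rows by
  \<open>t\<close> and its columns by \<open>1 / t\<close> changes the value on the new edge only.\<close>

lemma torus_transitive_insert:
  assumes transitive: "torus_transitive TYPE('a::field) F"
    and F: "\<And>r c. (r, c) \<in> F \<Longrightarrow> r \<in> R \<longleftrightarrow> c \<in> C" and e: "(r0 \<in> R) \<noteq> (c0 \<in> C)"
  shows "torus_transitive TYPE('a) (insert (r0, c0) F)"
  unfolding torus_transitive_def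
proof (intro allI impI)
  fix \<phi> :: "_ \<Rightarrow> 'a" assume \<phi>: "\<forall>e\<in>insert (r0, c0) F. \<phi> e \<noteq> 0"
  then have "\<forall>e\<in>F. \<phi> e \<noteq> 0" by simp
  then obtain x y where x: "\<And>r. x r \<noteq> 0" and y: "\<And>c. y c \<noteq> 0"
    and xy: "\<And>r c. (r, c) \<in> F \<Longrightarrow> x r * y c = \<phi> (r, c)"
    using transitive unfolding torus_transitive_def by blast
  define s where "s = \<phi> (r0, c0) / (x r0 * y c0)"
  have s: "s \<noteq> 0" using \<phi> x y by (simp add: s_def)
  define t where "t = (if r0 \<in> R then s else 1 / s)"
  have t: "t \<noteq> 0" using s by (simp add: t_def)
  define x' where "x' r = (if r \<in> R then x r * t else x r)" for r
  define y' where "y' c = (if c \<in> C then y c / t else y c)" for c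
  have "x' r * y' c = \<phi> (r, c)" if "(r, c) \<in> F" for r c
    using F[OF that] xy[OF that] t by (auto simp: x'_def y'_def)
  moreover have "x' r0 * y' c0 = \<phi> (r0, c0)"
    using e x y s by (auto simp: x'_def y'_def t_def) (auto simp: s_def)
  ultimately show "\<exists>x y. (\<forall>r. x r \<noteq> 0) \<and> (\<forall>c. y c \<noteq> 0) \<and>
      (\<forall>r c. (r, c) \<in> insert (r0, c0) F \<longrightarrow> x r * y c = \<phi> (r, c))"
    using x y t by (intro exI[of _ x'] exI[of _ y']) (auto simp: x'_def y'_def)
qed

lemma torus_transitive_rook_placement:
  assumes "rook_placement \<mu>"
  shows "torus_transitive TYPE('a::field) \<mu>"
  using assms
proof (induction rule: rook_placement_induct)
  case empty
  show ?case by (rule torus_transitive_empty)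
next
  case (insert i j \<mu>)
  show ?case
    by (rule torus_transitive_insert[where R = "{i}" and C = "{}"]) (use insert in force)+
qed

lemma support_weight_mult:
  fixes \<sigma> :: "('r \<times> 'c) set"
  assumes fin: "finite \<sigma>"
  shows "(int CARD('a) - 1) ^ d * support_weight TYPE('a::{field,finite}) d \<sigma> =
    int (card (supp_rank_funs \<sigma> d :: ('r \<times> 'c \<Rightarrow> 'a) set))"
proof -
  have "(CARD('a) - 1) ^ d dvd card (supp_rank_funs \<sigma> d :: ('r \<times> 'c \<Rightarrow> 'a) set)"
  proof (cases "supp_rank_funs \<sigma> d = ({} :: ('r \<times> 'c \<Rightarrow> 'a) set)")
    case False
    then obtain f :: "'r \<times> 'c \<Rightarrow> 'a" where f: "fun_supp f = \<sigma>" "has_rank f d"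
      by (auto simp: supp_rank_funs_def)
    then obtain \<mu> where "\<mu> \<subseteq> \<sigma>" "rook_placement \<mu>" "card \<mu> = d"
      using has_rank_rook_placement fin by metis
    then show ?thesis
      using torus_transitive_dvd_card[OF torus_transitive_rook_placement _ fin] by blast
  qed simp
  then have "int ((CARD('a) - 1) ^ d) dvd int (card (supp_rank_funs \<sigma> d :: ('r \<times> 'c \<Rightarrow> 'a) set))"
    by (simp only: of_nat_dvd_iff)
  then show ?thesis using card_field_gt_1[where 'a = 'a] by (simp add: support_weight_def)
qed

section \<open>Classification of the supports\<close>

lemma torus_transitive_two_extra_edges:
  assumes \<mu>: "rook_placement \<mu>" and e: "(r, c) \<notin> \<mu>" and e': "(r', c') \<notin> \<mu>" "(r, c) \<noteq> (r', c')"
    and not_parallel: "\<not> ((r, c') \<in> \<mu> \<and> (r', c) \<in> \<mu>)"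
  shows "torus_transitive TYPE('a::field) (insert (r', c') (insert (r, c) \<mu>))"
proof -
  have row: "x \<in> {i} \<longleftrightarrow> y \<in> {j. (i, j) \<in> \<mu>}" if "(x, y) \<in> \<mu>" for x y i
    using that rook_placementD[OF \<mu>] by blast
  have col: "x \<in> {i. (i, j) \<in> \<mu>} \<longleftrightarrow> y \<in> {j}" if "(x, y) \<in> \<mu>" for x y j
    using that rook_placementD[OF \<mu>] by blast
  have transitive: "torus_transitive TYPE('a) (insert (r, c) \<mu>)"
    by (rule torus_transitive_insert[OF torus_transitive_rook_placement[OF \<mu>] row[of _ _ r]])
      (use e in auto)
  show ?thesis
  proof (cases "r = r' \<longleftrightarrow> (r', c) \<in> \<mu>")
    case True
    have "x \<in> {r'} \<longleftrightarrow> y \<in> {j. (r', j) \<in> \<mu>}" if "(x, y) \<in> insert (r, c) \<mu>" for x y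
      using that row[of x y r'] True by auto
    then show ?thesis by (rule torus_transitive_insert[OF transitive]) (use e' in auto)
  next
    case False
    have "x \<in> {i. (i, c') \<in> \<mu>} \<longleftrightarrow> y \<in> {c'}" if "(x, y) \<in> insert (r, c) \<mu>" for x y
      using that col[of x y c'] False not_parallel e e' by auto
    then show ?thesis by (rule torus_transitive_insert[OF transitive]) (use e' in auto)
  qed
qed

lemma graph_placement_Un:
  assumes \<mu>: "rook_placement \<mu>" and \<rho>: "\<rho> \<subseteq> \<mu>" "\<rho> \<subseteq> \<tau>" and "is_copy G \<tau>"
    and disj: "fst ` \<tau> \<inter> fst ` \<mu> \<subseteq> fst ` \<rho>" "snd ` \<tau> \<inter> snd ` \<mu> \<subseteq> snd ` \<rho>"
  shows "graph_placement G (int (card \<mu>) - int (card \<rho>)) (\<tau> \<union> \<mu>)"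
proof -
  have inj: "inj_on fst \<mu>" "inj_on snd \<mu>" and fin: "finite \<mu>"
    using \<mu> by (auto simp: rook_placement_def)
  have "rook_placement (\<mu> - \<rho>)" by (rule rook_placement_subset[OF \<mu>]) auto
  moreover have "int (card (\<mu> - \<rho>)) = int (card \<mu>) - int (card \<rho>)"
    using card_Diff_subset[OF finite_subset[OF \<rho>(1) fin] \<rho>(1)] card_mono[OF fin \<rho>(1)] by simp
  moreover have "fst ` \<tau> \<inter> fst ` (\<mu> - \<rho>) = {}" "snd ` \<tau> \<inter> snd ` (\<mu> - \<rho>) = {}"
    unfolding inj_on_image_set_diff[OF inj(1) Diff_subset \<rho>(1)]
      inj_on_image_set_diff[OF inj(2) Diff_subset \<rho>(1)] using disj by auto
  moreover have "\<tau> \<union> \<mu> = \<tau> \<union> (\<mu> - \<rho>)" using \<rho>(2) by auto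
  ultimately show ?thesis
    unfolding graph_placement_def placement_with_def using assms(4) by blast
qed

lemma rook_placement_insert_cases:
  assumes \<mu>: "rook_placement \<mu>" and e: "(r, c) \<notin> \<mu>"
  obtains "rook_placement (insert (r, c) \<mu>)"
  | "graph_placement ZG (int (card \<mu>) - 2) (insert (r, c) \<mu>)"
  | "graph_placement WRG (int (card \<mu>) - 1) (insert (r, c) \<mu>)"
  | "graph_placement WCG (int (card \<mu>) - 1) (insert (r, c) \<mu>)"
proof (cases "r \<in> fst ` \<mu>"; cases "c \<in> snd ` \<mu>")
  assume "r \<in> fst ` \<mu>" "c \<in> snd ` \<mu>"
  then obtain r1 c1 where rc: "(r, c1) \<in> \<mu>" "(r1, c) \<in> \<mu>" by auto
  then have ne: "r \<noteq> r1" "c1 \<noteq> c" using e by auto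
  then have "is_copy ZG {(r, c1), (r, c), (r1, c)}" by (auto simp: is_copy_ZG_iff)
  then have "graph_placement ZG (int (card \<mu>) - int (card {(r, c1), (r1, c)}))
      ({(r, c1), (r, c), (r1, c)} \<union> \<mu>)"
    using rc by (intro graph_placement_Un[OF \<mu>]) auto
  then show thesis using that(2) ne rc by (simp add: insert_absorb)
next
  assume "r \<in> fst ` \<mu>" "c \<notin> snd ` \<mu>"
  then obtain c1 where rc: "(r, c1) \<in> \<mu>" "c1 \<noteq> c" by force
  then have "is_copy WCG {(r, c1), (r, c)}" by (auto simp: is_copy_WCG_iff)
  then have "graph_placement WCG (int (card \<mu>) - int (card {(r, c1)})) ({(r, c1), (r, c)} \<union> \<mu>)"
    using rc \<open>c \<notin> snd ` \<mu>\<close> by (intro graph_placement_Un[OF \<mu>]) auto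
  then show thesis using that(4) rc by (simp add: insert_absorb)
next
  assume "r \<notin> fst ` \<mu>" "c \<in> snd ` \<mu>"
  then obtain r1 where rc: "(r1, c) \<in> \<mu>" "r1 \<noteq> r" by force
  then have "is_copy WRG {(r1, c), (r, c)}" by (auto simp: is_copy_WRG_iff)
  then have "graph_placement WRG (int (card \<mu>) - int (card {(r1, c)})) ({(r1, c), (r, c)} \<union> \<mu>)"
    using rc \<open>r \<notin> fst ` \<mu>\<close> by (intro graph_placement_Un[OF \<mu>]) auto
  then show thesis using that(3) rc by (simp add: insert_absorb)
next
  assume "r \<notin> fst ` \<mu>" "c \<notin> snd ` \<mu>"
  then show thesis by (rule that(1)[OF rook_placement_insert[OF \<mu>]])
qed

lemma graph_placement_SG_insert:
  assumes \<mu>: "rook_placement \<mu>" and "(r, c') \<in> \<mu>" "(r', c) \<in> \<mu>" and "(r, c) \<notin> \<mu>"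
  shows "graph_placement SG (int (card \<mu>) - 2) (insert (r', c') (insert (r, c) \<mu>))"
proof -
  have ne: "r \<noteq> r'" "c' \<noteq> c" using assms by auto
  then have "is_copy SG {(r, c), (r, c'), (r', c), (r', c')}" by (auto simp: is_copy_SG_iff)
  then have "graph_placement SG (int (card \<mu>) - int (card {(r, c'), (r', c)}))
      ({(r, c), (r, c'), (r', c), (r', c')} \<union> \<mu>)"
    using assms by (intro graph_placement_Un[OF \<mu>]) auto
  then show ?thesis using ne assms by (simp add: insert_absorb insert_commute)
qed

lemma extra_edges_parallel:
  assumes \<mu>: "rook_placement \<mu>" "\<mu> \<subseteq> \<sigma>"
    and none: "\<not> (\<exists>F\<subseteq>\<sigma>. torus_transitive TYPE('a::field) F \<and> card F = card \<mu> + 2)"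
    and e: "(r, c) \<in> \<sigma> - \<mu>" "(r', c') \<in> \<sigma> - \<mu>" "(r, c) \<noteq> (r', c')"
  shows "(r, c') \<in> \<mu> \<and> (r', c) \<in> \<mu>"
proof (rule ccontr)
  assume "\<not> ?thesis"
  then have "torus_transitive TYPE('a) (insert (r', c') (insert (r, c) \<mu>))"
    using e by (intro torus_transitive_two_extra_edges[OF \<mu>(1)]) auto
  moreover have "card (insert (r', c') (insert (r, c) \<mu>)) = card \<mu> + 2"
    using e rook_placement_finite[OF \<mu>(1)] by auto
  moreover have "insert (r', c') (insert (r, c) \<mu>) \<subseteq> \<sigma>" using e \<mu>(2) by auto
  ultimately show False using none by blast
qed

lemma rook_placement_extension_cases:
  fixes \<mu> \<sigma> :: "('r \<times> 'c) set"
  assumes \<mu>: "rook_placement \<mu>" and sub: "\<mu> \<subseteq> \<sigma>"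
  obtains "rook_placement \<sigma>"
  | "graph_placement ZG (int (card \<mu>) - 2) \<sigma>"
  | "graph_placement SG (int (card \<mu>) - 2) \<sigma>"
  | "graph_placement WRG (int (card \<mu>) - 1) \<sigma>"
  | "graph_placement WCG (int (card \<mu>) - 1) \<sigma>"
  | F where "F \<subseteq> \<sigma>" "torus_transitive TYPE('a::field) F" "card F = card \<mu> + 2"
proof (cases "\<exists>F\<subseteq>\<sigma>. torus_transitive TYPE('a) F \<and> card F = card \<mu> + 2")
  case True
  then show thesis using that(6) by blast
next
  case False
  note parallel = extra_edges_parallel[OF \<mu> sub False]
  consider (equal) "\<sigma> = \<mu>" | (one_extra) r c where "(r, c) \<notin> \<mu>" "\<sigma> = insert (r, c) \<mu>"
    | (two_extra) r c r' c' where "(r, c) \<in> \<sigma> - \<mu>" "(r', c') \<in> \<sigma> - \<mu>" "(r, c) \<noteq> (r', c')"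
    using sub by fast
  then show thesis
  proof cases
    case equal
    then show thesis using that(1) \<mu> by simp
  next
    case (one_extra r c)
    from \<mu> one_extra(1) show thesis
      by (cases rule: rook_placement_insert_cases) (use that(1,2,4,5) one_extra(2) in simp_all)
  next
    case (two_extra r c r' c')
    have rc: "(r, c') \<in> \<mu>" "(r', c) \<in> \<mu>" using parallel[OF two_extra] by auto
    have "x = r' \<and> y = c'" if "(x, y) \<in> \<sigma> - \<mu>" "(x, y) \<noteq> (r, c)" for x y
      using rc parallel[OF two_extra(1) that(1)] that(2) rook_placementD[OF \<mu>] by blast
    then have "\<sigma> = insert (r', c') (insert (r, c) \<mu>)" using two_extra(1,2) sub by fast
    then show thesis using graph_placement_SG_insert[OF \<mu> rc] two_extra(1) by (intro that(3)) auto
  qed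
qed

lemma dvd_support_weight_unclassified:
  fixes \<sigma> :: "('r \<times> 'c) set"
  assumes fin: "finite \<sigma>" and "\<not> (rook_placement \<sigma> \<and> card \<sigma> = d)"
    and "\<not> graph_placement ZG (int d - 2) \<sigma>" "\<not> graph_placement SG (int d - 2) \<sigma>"
    and "\<not> graph_placement WRG (int d - 1) \<sigma>" "\<not> graph_placement WCG (int d - 1) \<sigma>"
  shows "(int CARD('a) - 1)\<^sup>2 dvd support_weight TYPE('a::{field,finite}) d \<sigma>"
proof (cases "supp_rank_funs \<sigma> d = ({} :: ('r \<times> 'c \<Rightarrow> 'a) set)")
  case True
  then show ?thesis by (simp add: support_weight_def)
next
  case False
  then obtain f :: "'r \<times> 'c \<Rightarrow> 'a" where f: "fun_supp f = \<sigma>" "has_rank f d"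
    by (auto simp: supp_rank_funs_def)
  then obtain \<mu> where \<mu>: "\<mu> \<subseteq> \<sigma>" "rook_placement \<mu>" "card \<mu> = d"
    using has_rank_rook_placement fin by metis
  have not_rook: "\<not> rook_placement \<sigma>"
    using assms(2) has_rank_unique[OF f(2)] has_rank_rook_placement_support[OF _ f(1)] by blast
  from \<mu>(2,1) obtain F where "F \<subseteq> \<sigma>" "torus_transitive TYPE('a) F" "card F = d + 2"
    by (rule rook_placement_extension_cases) (use not_rook assms(3-6) \<mu>(3) in auto)
  then show ?thesis using torus_transitive_dvd_support_weight[OF _ _ fin] by blast
qed

text \<open>The five kinds of supports are told apart by their numbers of edges, rows and columns.\<close>

lemma support_weight_cong:
  fixes \<sigma> :: "('r \<times> 'c) set"
  assumes fin: "finite \<sigma>"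
  defines "q \<equiv> int CARD('a::{field,finite})"
  shows "[support_weight TYPE('a) d \<sigma> = of_bool (rook_placement \<sigma> \<and> card \<sigma> = d) + (q - 1) *
      (of_bool (graph_placement ZG (int d - 2) \<sigma>) - of_bool (graph_placement SG (int d - 2) \<sigma>)
       + of_bool (graph_placement WRG (int d - 1) \<sigma>) + of_bool (graph_placement WCG (int d - 1) \<sigma>))]
    (mod (q - 1)\<^sup>2)"
    (is "[?w = of_bool ?rook + _ * (of_bool ?ZG - of_bool ?SG + of_bool ?WRG + of_bool ?WCG)] (mod _)")
proof -
  note weights = support_weight_exceptional[of d \<sigma>, where 'a = 'a, folded q_def]
  note profiles = profile_rook_placement[of \<sigma>] profile_exceptional[of "int d" \<sigma>]
  consider (rook) ?rook | (ZG) ?ZG | (SG) ?SG | (WRG) ?WRG | (WCG) ?WCG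
    | (other) "\<not> ?rook" "\<not> ?ZG" "\<not> ?SG" "\<not> ?WRG" "\<not> ?WCG" by blast
  then show ?thesis
  proof cases
    case rook
    then have "?w = 1" using support_weight_rook_placement[of \<sigma>, where 'a = 'a] by auto
    moreover have "\<not> ?ZG" "\<not> ?SG" "\<not> ?WRG" "\<not> ?WCG" using rook profiles by auto
    ultimately show ?thesis using rook by simp
  next
    case ZG
    then have "\<not> ?rook" "\<not> ?SG" "\<not> ?WRG" "\<not> ?WCG" using profiles by auto
    then show ?thesis using ZG weights(1) by auto
  next
    case SG
    then have "\<not> ?rook" "\<not> ?ZG" "\<not> ?WRG" "\<not> ?WCG" using profiles by auto
    then show ?thesis using SG weights(2) by (auto simp: cong_iff_dvd_diff)
  next
    case WRG
    then have "\<not> ?rook" "\<not> ?ZG" "\<not> ?SG" "\<not> ?WCG" using profiles by auto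
    then show ?thesis using WRG weights(3) by auto
  next
    case WCG
    then have "\<not> ?rook" "\<not> ?ZG" "\<not> ?SG" "\<not> ?WRG" using profiles by auto
    then show ?thesis using WCG weights(4) by auto
  next
    case other
    then show ?thesis
      using dvd_support_weight_unclassified[OF fin, of d, where 'a = 'a]
      by (auto simp: q_def cong_iff_dvd_diff)
  qed
qed

section \<open>Graph isomorphism\<close>

definition no_isolated_vertices :: "('r, 'c) bigraph \<Rightarrow> bool" where
  "no_isolated_vertices G \<longleftrightarrow> fst ` edges G = row_verts G \<and> snd ` edges G = col_verts G"

lemma edges_subset_if_no_isolated_vertices:
  "no_isolated_vertices G \<Longrightarrow> edges G \<subseteq> row_verts G \<times> col_verts G"
  unfolding no_isolated_vertices_def by (metis subset_fst_snd)

lemma image_fst_snd_map_prod: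
  assumes "no_isolated_vertices G"
  shows "fst ` map_prod f g ` edges G = f ` row_verts G" (is ?rows)
    and "snd ` map_prod f g ` edges G = g ` col_verts G" (is ?cols)
proof -
  have "fst ` map_prod f g ` edges G = f ` fst ` edges G"
    and "snd ` map_prod f g ` edges G = g ` snd ` edges G" by (simp_all add: image_image)
  then show ?rows ?cols using assms by (simp_all add: no_isolated_vertices_def)
qed

lemma image_Plus: "h ` (A <+> B) = (h \<circ> Inl) ` A \<union> (h \<circ> Inr) ` B"
  by (simp add: Plus_def image_Un image_comp)

lemma inj_on_Plus_iff:
  "inj_on h (A <+> B) \<longleftrightarrow>
     inj_on (h \<circ> Inl) A \<and> inj_on (h \<circ> Inr) B \<and> (h \<circ> Inl) ` A \<inter> (h \<circ> Inr) ` B = {}"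
proof -
  have "inj_on Inl A" "inj_on Inr B" by simp_all
  moreover have "Inl ` A - Inr ` B = Inl ` A" "Inr ` B - Inl ` A = Inr ` B" by auto
  ultimately show ?thesis by (simp add: Plus_def inj_on_Un comp_inj_on_iff image_comp)
qed

lemma bij_betw_Plus_padding:
  assumes "inj_on f A" "f ` A \<subseteq> S" "finite S"
  obtains k h where "bij_betw h (A <+> {1..k :: nat}) S" "h \<circ> Inl = f"
proof -
  obtain s where s: "bij_betw s {1..card (S - f ` A)} (S - f ` A)"
    using ex_bij_betw_nat_finite_1[of "S - f ` A"] assms(3) by auto
  have "bij_betw (case_sum f s) (A <+> {1..card (S - f ` A)}) S"
    unfolding bij_betw_def inj_on_Plus_iff image_Plus case_sum_o_inj
    using s assms by (auto simp: bij_betw_def)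
  then show thesis by (rule that) (simp add: case_sum_o_inj)
qed

lemma bigraph_iso_sym:
  assumes "bigraph_iso G H"
  shows "bigraph_iso H G"
proof -
  obtain f g where f: "bij_betw f (row_verts G) (row_verts H)"
    and g: "bij_betw g (col_verts G) (col_verts H)"
    and e: "\<And>r c. r \<in> row_verts G \<Longrightarrow> c \<in> col_verts G \<Longrightarrow> (r, c) \<in> edges G \<longleftrightarrow> (f r, g c) \<in> edges H"
    using assms unfolding bigraph_iso_def by blast
  let ?f = "inv_into (row_verts G) f" and ?g = "inv_into (col_verts G) g"
  have "(r, c) \<in> edges H \<longleftrightarrow> (?f r, ?g c) \<in> edges G" if "r \<in> row_verts H" "c \<in> col_verts H" for r c
  proof -
    have "?f r \<in> row_verts G" "?g c \<in> col_verts G" "f (?f r) = r" "g (?g c) = c"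
      using that f g by (auto simp: bij_betw_def inv_into_into f_inv_into_f)
    then show ?thesis using e[of "?f r" "?g c"] by simp
  qed
  moreover have "bij_betw ?f (row_verts H) (row_verts G)" "bij_betw ?g (col_verts H) (col_verts G)"
    using f g by (auto intro: bij_betw_inv_into)
  ultimately show ?thesis unfolding bigraph_iso_def by (intro exI[of _ ?f] exI[of _ ?g]) simp
qed

lemma bigraph_iso_iff_image_edges:
  assumes G: "edges G \<subseteq> row_verts G \<times> col_verts G" and H: "edges H \<subseteq> row_verts H \<times> col_verts H"
  shows "bigraph_iso G H \<longleftrightarrow> (\<exists>f g. bij_betw f (row_verts G) (row_verts H) \<and>
    bij_betw g (col_verts G) (col_verts H) \<and> map_prod f g ` edges G = edges H)"
proof -
  have "(\<forall>r\<in>row_verts G. \<forall>c\<in>col_verts G. (r, c) \<in> edges G \<longleftrightarrow> (f r, g c) \<in> edges H) \<longleftrightarrow>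
      map_prod f g ` edges G = edges H" (is "?L \<longleftrightarrow> ?R")
    if f: "bij_betw f (row_verts G) (row_verts H)" and g: "bij_betw g (col_verts G) (col_verts H)" for f g
  proof
    assume ?L
    have surj: "map_prod f g ` (row_verts G \<times> col_verts G) = row_verts H \<times> col_verts H"
      using f g by (simp add: bij_betw_def map_prod_surj_on)
    have "e \<in> map_prod f g ` edges G" if e: "e \<in> edges H" for e
    proof -
      have "e \<in> map_prod f g ` (row_verts G \<times> col_verts G)" unfolding surj using e H by blast
      then obtain r c where rc: "r \<in> row_verts G" "c \<in> col_verts G" "e = map_prod f g (r, c)"
        by (elim imageE SigmaE) simp
      then have "(r, c) \<in> edges G" using \<open>?L\<close> e by simp
      then show ?thesis unfolding rc(3) by (rule imageI)
    qed
    then show ?R using \<open>?L\<close> G by auto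
  next
    assume ?R
    have "inj_on (map_prod f g) (row_verts G \<times> col_verts G)"
      using f g by (simp add: bij_betw_def map_prod_inj_on)
    from inj_on_image_mem_iff[OF this _ G]
    have "map_prod f g (r, c) \<in> edges H \<longleftrightarrow> (r, c) \<in> edges G"
      if "r \<in> row_verts G" "c \<in> col_verts G" for r c
      unfolding \<open>?R\<close> using that by blast
    then show ?L by simp
  qed
  then show ?thesis unfolding bigraph_iso_def by blast
qed

lemma bigraph_union_sel:
  "row_verts (bigraph_union G H) = row_verts G <+> row_verts H"
  "col_verts (bigraph_union G H) = col_verts G <+> col_verts H"
  "edges (bigraph_union G H) = map_prod Inl Inl ` edges G \<union> map_prod Inr Inr ` edges H"
  by (simp_all add: bigraph_union_def)

lemma map_prod_edges_bigraph_union: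
  "map_prod f g ` edges (bigraph_union G H) =
    map_prod (f \<circ> Inl) (g \<circ> Inl) ` edges G \<union> map_prod (f \<circ> Inr) (g \<circ> Inr) ` edges H"
  by (simp add: bigraph_union_sel image_Un image_comp map_prod_compose)

lemma no_isolated_vertices_bigraph_union:
  assumes "no_isolated_vertices G" "no_isolated_vertices H"
  shows "no_isolated_vertices (bigraph_union G H)"
  unfolding no_isolated_vertices_def bigraph_union_sel image_Un
    image_fst_snd_map_prod[OF assms(1)] image_fst_snd_map_prod[OF assms(2)] by (simp add: Plus_def)

lemma is_copy_bigraph_union_iff:
  assumes "no_isolated_vertices G" "no_isolated_vertices H"
  shows "is_copy (bigraph_union G H) \<sigma> \<longleftrightarrow> (\<exists>\<tau> \<mu>. is_copy G \<tau> \<and> is_copy H \<mu> \<and>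
    fst ` \<tau> \<inter> fst ` \<mu> = {} \<and> snd ` \<tau> \<inter> snd ` \<mu> = {} \<and> \<sigma> = \<tau> \<union> \<mu>)"
    (is "_ \<longleftrightarrow> ?split")
proof
  note ends = image_fst_snd_map_prod[OF assms(1)] image_fst_snd_map_prod[OF assms(2)]
  show ?split if copy: "is_copy (bigraph_union G H) \<sigma>"
  proof -
    obtain f g where fg: "inj_on f (row_verts G <+> row_verts H)" "inj_on g (col_verts G <+> col_verts H)"
      and \<sigma>: "\<sigma> = map_prod f g ` edges (bigraph_union G H)"
      using copy unfolding is_copy_def bigraph_union_sel(1,2) by blast
    let ?\<tau> = "map_prod (f \<circ> Inl) (g \<circ> Inl) ` edges G" and ?\<mu> = "map_prod (f \<circ> Inr) (g \<circ> Inr) ` edges H"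
    have "is_copy G ?\<tau>" "is_copy H ?\<mu>" "fst ` ?\<tau> \<inter> fst ` ?\<mu> = {}" "snd ` ?\<tau> \<inter> snd ` ?\<mu> = {}"
      using fg unfolding inj_on_Plus_iff is_copy_def ends by blast+
    then show ?split unfolding \<sigma> map_prod_edges_bigraph_union by blast
  qed
  show "is_copy (bigraph_union G H) \<sigma>" if ?split
  proof -
    obtain \<tau> \<mu> where "is_copy G \<tau>" "is_copy H \<mu>"
      and disj: "fst ` \<tau> \<inter> fst ` \<mu> = {}" "snd ` \<tau> \<inter> snd ` \<mu> = {}" and \<sigma>: "\<sigma> = \<tau> \<union> \<mu>"
      using \<open>?split\<close> by blast
    then obtain f g f' g' where inj: "inj_on f (row_verts G)" "inj_on g (col_verts G)"
        "inj_on f' (row_verts H)" "inj_on g' (col_verts H)"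
      and \<tau>: "\<tau> = map_prod f g ` edges G" and \<mu>: "\<mu> = map_prod f' g' ` edges H"
      unfolding is_copy_def by blast
    have "inj_on (case_sum f f') (row_verts G <+> row_verts H)"
      "inj_on (case_sum g g') (col_verts G <+> col_verts H)"
      using inj disj unfolding \<tau> \<mu> ends inj_on_Plus_iff case_sum_o_inj by blast+
    moreover have "\<sigma> = map_prod (case_sum f f') (case_sum g g') ` edges (bigraph_union G H)"
      by (simp add: \<sigma> \<tau> \<mu> map_prod_edges_bigraph_union case_sum_o_inj)
    ultimately show ?thesis unfolding is_copy_def bigraph_union_sel(1,2) by blast
  qed
qed

lemma ex_bigraph_iso_union_edgeless_iff:
  assumes \<sigma>: "\<sigma> \<subseteq> {1..m} \<times> {1..n}" and H: "no_isolated_vertices H"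
  shows "(\<exists>a b. bigraph_iso (board_graph m n \<sigma>) (bigraph_union H (edgeless a b))) \<longleftrightarrow> is_copy H \<sigma>"
proof -
  have edges: "edges (bigraph_union H (edgeless a b)) \<subseteq>
      (row_verts H <+> {1..a}) \<times> (col_verts H <+> {1..b})" for a b
    using edges_subset_if_no_isolated_vertices[OF H] by (auto simp: bigraph_union_def edgeless_def)
  have "bigraph_iso (board_graph m n \<sigma>) (bigraph_union H (edgeless a b)) \<longleftrightarrow>
      bigraph_iso (bigraph_union H (edgeless a b)) (board_graph m n \<sigma>)" for a b
    by (rule iffI) (erule bigraph_iso_sym)+
  also have "bigraph_iso (bigraph_union H (edgeless a b)) (board_graph m n \<sigma>) \<longleftrightarrow>
      (\<exists>f g. bij_betw f (row_verts H <+> {1..a}) {1..m} \<and> bij_betw g (col_verts H <+> {1..b}) {1..n} \<and>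
        map_prod (f \<circ> Inl) (g \<circ> Inl) ` edges H = \<sigma>)" for a b
    using bigraph_iso_iff_image_edges[of "bigraph_union H (edgeless a b)" "board_graph m n \<sigma>"]
      \<sigma> edges[of a b]
    by (simp add: map_prod_edges_bigraph_union) (simp add: bigraph_union_sel board_graph_def edgeless_def)
  finally have iso_iff: "bigraph_iso (board_graph m n \<sigma>) (bigraph_union H (edgeless a b)) \<longleftrightarrow>
      (\<exists>f g. bij_betw f (row_verts H <+> {1..a}) {1..m} \<and> bij_betw g (col_verts H <+> {1..b}) {1..n} \<and>
        map_prod (f \<circ> Inl) (g \<circ> Inl) ` edges H = \<sigma>)" for a b .
  show ?thesis
    unfolding iso_iff
  proof
    assume "is_copy H \<sigma>"
    then obtain f g where f: "inj_on f (row_verts H)" and g: "inj_on g (col_verts H)"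
      and \<sigma>_eq: "\<sigma> = map_prod f g ` edges H" unfolding is_copy_def by blast
    have "f ` row_verts H \<subseteq> {1..m}" "g ` col_verts H \<subseteq> {1..n}"
      unfolding image_fst_snd_map_prod[OF H, of f g, symmetric] \<sigma>_eq[symmetric] using \<sigma> by auto
    then obtain a b \<Phi> \<Psi> where "bij_betw \<Phi> (row_verts H <+> {1..a :: nat}) {1..m}" "\<Phi> \<circ> Inl = f"
      "bij_betw \<Psi> (col_verts H <+> {1..b :: nat}) {1..n}" "\<Psi> \<circ> Inl = g"
      using bij_betw_Plus_padding[OF f _ finite_atLeastAtMost]
        bij_betw_Plus_padding[OF g _ finite_atLeastAtMost] by metis
    then show "\<exists>a b f g. bij_betw f (row_verts H <+> {1..a :: nat}) {1..m} \<and>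
        bij_betw g (col_verts H <+> {1..b :: nat}) {1..n} \<and> map_prod (f \<circ> Inl) (g \<circ> Inl) ` edges H = \<sigma>"
      by (intro exI[of _ a] exI[of _ b] exI[of _ \<Phi>] exI[of _ \<Psi>]) (simp add: \<sigma>_eq)
  qed (auto simp: is_copy_def bij_betw_def inj_on_Plus_iff)
qed

lemma bigraph_copies_EG_sel:
  "row_verts (bigraph_copies i EG) = (\<lambda>k. (k, 1)) ` {1..i}"
  "col_verts (bigraph_copies i EG) = (\<lambda>k. (k, 1)) ` {1..i}"
  "edges (bigraph_copies i EG) = (\<lambda>k. ((k, 1), (k, 1))) ` {1..i}"
  by (auto simp: bigraph_copies_def EG_def)

lemma no_isolated_vertices_copies_EG: "no_isolated_vertices (bigraph_copies i EG)"
  by (simp add: no_isolated_vertices_def bigraph_copies_EG_sel image_image)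

lemma is_copy_copies_EG_iff: "is_copy (bigraph_copies i EG) \<mu> \<longleftrightarrow> rook_placement \<mu> \<and> card \<mu> = i"
proof
  assume "is_copy (bigraph_copies i EG) \<mu>"
  then obtain f g where fg: "inj_on f ((\<lambda>k. (k, 1 :: nat)) ` {1..i})"
      "inj_on g ((\<lambda>k. (k, 1 :: nat)) ` {1..i})"
    and \<mu>: "\<mu> = (\<lambda>k. (f (k, 1), g (k, 1))) ` {1..i}"
    unfolding is_copy_def bigraph_copies_EG_sel by (auto simp: image_image)
  define u v where "u k = f (k, 1)" and "v k = g (k, 1)" for k
  have "inj_on (\<lambda>k. (k, 1 :: nat)) {1..i}" by (rule inj_onI) simp
  then have u: "inj_on u {1..i}" and v: "inj_on v {1..i}"
    unfolding u_def v_def using comp_inj_on[OF _ fg(1)] comp_inj_on[OF _ fg(2)] by (simp_all only: comp_def)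
  have \<mu>: "\<mu> = (\<lambda>k. (u k, v k)) ` {1..i}" unfolding u_def v_def by (rule \<mu>)
  have "inj_on (\<lambda>k. (u k, v k)) {1..i}" by (rule inj_onI, rule inj_onD[OF u]) auto
  then have "card \<mu> = i" by (simp add: \<mu> card_image)
  moreover have "inj_on fst \<mu>" "inj_on snd \<mu>"
    unfolding \<mu> by (rule inj_on_imageI, simp only: comp_def fst_conv snd_conv u v)+
  ultimately show "rook_placement \<mu> \<and> card \<mu> = i" by (simp add: rook_placement_def \<mu>)
next
  assume \<mu>: "rook_placement \<mu> \<and> card \<mu> = i"
  then obtain h where h: "bij_betw h {1..i} \<mu>"
    using ex_bij_betw_nat_finite_1 rook_placement_finite by blast
  then have inj: "inj_on (fst \<circ> h) {1..i}" "inj_on (snd \<circ> h) {1..i}"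
    using \<mu> by (auto simp: rook_placement_def bij_betw_def intro: comp_inj_on)
  show "is_copy (bigraph_copies i EG) \<mu>"
    unfolding is_copy_def bigraph_copies_EG_sel
  proof (intro exI conjI)
    show "inj_on (fst \<circ> h \<circ> fst) ((\<lambda>k. (k, 1)) ` {1..i})"
      and "inj_on (snd \<circ> h \<circ> fst) ((\<lambda>k. (k, 1)) ` {1..i})"
      by (rule inj_on_imageI, unfold comp_def fst_conv, rule inj[unfolded comp_def])+
    show "\<mu> = map_prod (fst \<circ> h \<circ> fst) (snd \<circ> h \<circ> fst) ` (\<lambda>k. ((k, 1), (k, 1))) ` {1..i}"
      using h by (simp add: image_image bij_betw_def)
  qed
qed

lemma graph_rook_number_eq:
  assumes B: "B \<subseteq> {1..m} \<times> {1..n}" and G: "no_isolated_vertices G"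
  shows "graph_rook_number G i m n B = card {\<sigma> \<in> Pow B. graph_placement G i \<sigma>}"
proof (cases "i < 0")
  case True
  then have "\<not> graph_placement G i \<sigma>" for \<sigma> :: board
    by (auto simp: graph_placement_def placement_with_def)
  then show ?thesis using True by (simp add: graph_rook_number_def)
next
  case False
  let ?H = "bigraph_union G (bigraph_copies (nat i) EG)"
  have H: "no_isolated_vertices ?H"
    by (rule no_isolated_vertices_bigraph_union[OF G no_isolated_vertices_copies_EG])
  have "(\<exists>a b. bigraph_iso (board_graph m n \<sigma>) (bigraph_union ?H (edgeless a b))) \<longleftrightarrow>
      graph_placement G i \<sigma>" if "\<sigma> \<subseteq> B" for \<sigma>
  proof -
    have "(\<exists>a b. bigraph_iso (board_graph m n \<sigma>) (bigraph_union ?H (edgeless a b))) \<longleftrightarrow> is_copy ?H \<sigma>"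
      by (rule ex_bigraph_iso_union_edgeless_iff[OF _ H]) (use that B in blast)
    also have "\<dots> \<longleftrightarrow> graph_placement G i \<sigma>"
      unfolding is_copy_bigraph_union_iff[OF G no_isolated_vertices_copies_EG] is_copy_copies_EG_iff
        graph_placement_def placement_with_def
      using False by (auto simp: nat_eq_iff2)
    finally show ?thesis .
  qed
  then have "{\<sigma>. \<sigma> \<subseteq> B \<and> (\<exists>a b. bigraph_iso (board_graph m n \<sigma>) (bigraph_union ?H (edgeless a b)))} =
      {\<sigma> \<in> Pow B. graph_placement G i \<sigma>}" by auto
  then show ?thesis using False by (simp add: graph_rook_number_def)
qed

lemma no_isolated_vertices_exceptional:
  "no_isolated_vertices ZG" "no_isolated_vertices SG" "no_isolated_vertices WRG" "no_isolated_vertices WCG"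
  by (auto simp: no_isolated_vertices_def ZG_def SG_def WRG_def WCG_def)

section \<open>Counting matrices\<close>

definition mat_entries :: "'a::zero mat \<Rightarrow> nat \<times> nat \<Rightarrow> 'a" where
  "mat_entries A = (\<lambda>(i, j). if i \<in> {1..dim_row A} \<and> j \<in> {1..dim_col A} then A $$ (i - 1, j - 1) else 0)"

lemma fun_supp_mat_entries: "fun_supp (mat_entries A) = mat_support A"
proof -
  have "mat_entries A (i, j) \<noteq> 0 \<longleftrightarrow> (i, j) \<in> mat_support A" for i j
    by (cases i; cases j) (auto simp: mat_entries_def mat_support_def)
  then show ?thesis by auto
qed

lemma bij_betw_mat_entries:
  "bij_betw mat_entries (carrier_mat m n) {f :: nat \<times> nat \<Rightarrow> 'a::zero. fun_supp f \<subseteq> {1..m} \<times> {1..n}}"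
proof (rule bij_betw_byWitness[where f' = "\<lambda>f. mat m n (\<lambda>(i, j). f (Suc i, Suc j))"])
  show "\<forall>A\<in>carrier_mat m n. mat m n (\<lambda>(i, j). mat_entries A (Suc i, Suc j)) = (A :: 'a mat)"
    by (auto simp: mat_entries_def)
  show "\<forall>f\<in>{f :: nat \<times> nat \<Rightarrow> 'a. fun_supp f \<subseteq> {1..m} \<times> {1..n}}.
      mat_entries (mat m n (\<lambda>(i, j). f (Suc i, Suc j))) = f"
  proof (intro ballI ext)
    fix f :: "nat \<times> nat \<Rightarrow> 'a" and e :: "nat \<times> nat"
    assume "f \<in> {f. fun_supp f \<subseteq> {1..m} \<times> {1..n}}"
    moreover obtain i j where e: "e = (i, j)" by force
    ultimately have "f (i, j) = 0" if "\<not> (i \<in> {1..m} \<and> j \<in> {1..n})" using that by auto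
    then show "mat_entries (mat m n (\<lambda>(i, j). f (Suc i, Suc j))) e = f e"
      unfolding e by (cases i; cases j) (auto simp: mat_entries_def)
  qed
  show "mat_entries ` carrier_mat m n \<subseteq> {f :: nat \<times> nat \<Rightarrow> 'a. fun_supp f \<subseteq> {1..m} \<times> {1..n}}"
    by (auto simp: mat_entries_def split: if_splits)
qed auto

definition board_col :: "'a mat \<Rightarrow> nat \<Rightarrow> 'a vec" where
  "board_col A j = col A (j - 1)"

lemma mat_entries_board_col:
  assumes "A \<in> carrier_mat m n" "j \<in> {1..n}"
  shows "mat_entries A (i, j) = (if i \<in> {1..m} then board_col A j $ (i - 1) else 0)"
  using assms by (auto simp: mat_entries_def board_col_def)

lemma board_col_carrier: "A \<in> carrier_mat m n \<Longrightarrow> board_col A j \<in> carrier_vec m"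
  unfolding board_col_def by (rule carrier_vecI) simp

lemma (in vec_space) lincomb_board_cols_eq_zero_iff:
  assumes A: "A \<in> carrier_mat n nc" and J: "J \<subseteq> {1..nc}"
    and inj: "inj_on (board_col A) J"
  shows "lincomb b (board_col A ` J) = 0\<^sub>v n \<longleftrightarrow>
    (\<forall>i. (\<Sum>j\<in>J. b (board_col A j) * mat_entries A (i, j)) = 0)"
proof -
  have carrier: "board_col A ` J \<subseteq> carrier_vec n" using board_col_carrier[OF A] by blast
  have entry: "(\<Sum>j\<in>J. b (board_col A j) * mat_entries A (i, j)) =
      (if i \<in> {1..n} then lincomb b (board_col A ` J) $ (i - 1) else 0)" for i
  proof -
    have "lincomb b (board_col A ` J) $ (i - 1) = (\<Sum>j\<in>J. b (board_col A j) * board_col A j $ (i - 1))"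
      if "i \<in> {1..n}"
      using that lincomb_index[OF _ carrier, of "i - 1" b] unfolding sum.reindex[OF inj] comp_def by auto
    moreover have "(\<Sum>j\<in>J. b (board_col A j) * mat_entries A (i, j)) =
        (\<Sum>j\<in>J. b (board_col A j) * (if i \<in> {1..n} then board_col A j $ (i - 1) else 0))"
      using J by (intro sum.cong refl) (simp add: mat_entries_board_col[OF A] subset_eq)
    ultimately show ?thesis by auto
  qed
  have "finite (board_col A ` J)" using J finite_subset by blast
  then have dim: "dim_vec (lincomb b (board_col A ` J)) = n" using lincomb_dim[OF _ carrier] by blast
  show ?thesis
  proof
    assume "lincomb b (board_col A ` J) = 0\<^sub>v n"
    then show "\<forall>i. (\<Sum>j\<in>J. b (board_col A j) * mat_entries A (i, j)) = 0" by (auto simp: entry)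
  next
    assume "\<forall>i. (\<Sum>j\<in>J. b (board_col A j) * mat_entries A (i, j)) = 0"
    then have "lincomb b (board_col A ` J) $ i = 0" if "i < n" for i
      using that entry[of "Suc i"] by simp
    then show "lincomb b (board_col A ` J) = 0\<^sub>v n" using dim by (intro eq_vecI) auto
  qed
qed

lemma inj_on_board_col:
  assumes A: "A \<in> carrier_mat m n" and J: "J \<subseteq> {1..n}" and ind: "col_indep (mat_entries A) J"
  shows "inj_on (board_col A) J"
proof (rule inj_onI, rule ccontr)
  fix j j' assume j: "j \<in> J" "j' \<in> J" "board_col A j = board_col A j'" "j \<noteq> j'"
  have "mat_entries A (i, j') = mat_entries A (i, j)" for i
    using j J by (simp add: mat_entries_board_col[OF A] subset_eq)
  then have "\<not> col_indep (mat_entries A) (insert j' {j})"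
    using j(4) by (intro not_col_indep_insert_combination[where b = "\<lambda>_. 1"]) auto
  then show False using col_indep_subset[OF ind, of "{j', j}"] j(1,2) by blast
qed

lemma (in vec_space) col_indep_mat_entries_iff:
  assumes A: "A \<in> carrier_mat n nc" and J: "J \<subseteq> {1..nc}"
  shows "col_indep (mat_entries A) J \<longleftrightarrow> inj_on (board_col A) J \<and> lin_indpt (board_col A ` J)"
proof -
  have finJ: "finite J" using J finite_subset by blast
  have carrier: "board_col A ` J \<subseteq> carrier_vec n" using board_col_carrier[OF A] by blast
  have "col_indep (mat_entries A) J \<longleftrightarrow> lin_indpt (board_col A ` J)" if inj: "inj_on (board_col A) J"
  proof
    assume ind: "col_indep (mat_entries A) J"
    show "lin_indpt (board_col A ` J)"
    proof
      assume "lin_dep (board_col A ` J)"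
      then obtain b j where b: "lincomb b (board_col A ` J) = 0\<^sub>v n" "j \<in> J" "b (board_col A j) \<noteq> 0"
        using finite_lin_dep[of "board_col A ` J"] finJ carrier by auto
      have "\<forall>i. (\<Sum>j\<in>J. b (board_col A j) * mat_entries A (i, j)) = 0"
        using b(1) unfolding lincomb_board_cols_eq_zero_iff[OF A J inj] .
      then show False using col_indepD[OF ind, of "\<lambda>j. b (board_col A j)" j] b(2,3) by blast
    qed
  next
    assume indpt: "lin_indpt (board_col A ` J)"
    show "col_indep (mat_entries A) J"
    proof (rule col_indepI[OF finJ], rule ccontr)
      fix a j assume a: "\<And>i. (\<Sum>j\<in>J. a j * mat_entries A (i, j)) = 0" and j: "j \<in> J" "a j \<noteq> 0"
      define b where "b = a \<circ> inv_into J (board_col A)"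
      have b: "b (board_col A j) = a j" if "j \<in> J" for j
        using inv_into_f_f[OF inj that] by (simp add: b_def)
      then have "lincomb b (board_col A ` J) = 0\<^sub>v n"
        unfolding lincomb_board_cols_eq_zero_iff[OF A J inj] using a by simp
      then have "lin_dep (board_col A ` J)"
        using lin_dep_crit[where A = "board_col A ` J" and S = "board_col A ` J" and a = b
            and v = "board_col A j"] finJ j b[OF j(1)] by auto
      then show False using indpt by blast
    qed
  qed
  then show ?thesis using inj_on_board_col[OF A J] by blast
qed

lemma (in vec_space) has_rank_mat_entries:
  assumes A: "A \<in> carrier_mat n nc"
  shows "has_rank (mat_entries A) (rank A)"
proof -
  have "set (cols A) = col A ` {..<nc}" using A by (auto simp: cols_def)
  also have "{..<nc} = (\<lambda>j. j - 1) ` {1..nc}" by (force simp: image_iff)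
  also have "col A ` \<dots> = board_col A ` {1..nc}" by (simp only: image_image board_col_def[symmetric])
  finally have cols: "set (cols A) = board_col A ` {1..nc}" .
  have supp: "J \<subseteq> {1..nc}" if "col_indep (mat_entries A) J" for J
    using col_indep_subset_fun_supp[OF that] A by (auto simp: mat_entries_def split: if_splits)
  have upper: "card J \<le> rank A" if ind: "col_indep (mat_entries A) J" for J
  proof -
    have J: "inj_on (board_col A) J" "lin_indpt (board_col A ` J)" "board_col A ` J \<subseteq> set (cols A)"
      using ind supp[OF ind] col_indep_mat_entries_iff[OF A supp[OF ind]] cols by auto
    show ?thesis using rank_ge_card_indpt[OF A J(3,2)] card_image[OF J(1)] by simp
  qed
  obtain S where S: "maximal S (\<lambda>T. T \<subseteq> set (cols A) \<and> lin_indpt T)"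
    using maximal_exists[of "(\<lambda>T. T \<subseteq> set (cols A) \<and> lin_indpt T)" "card (set (cols A))" "{}"]
    by (meson List.finite_set card_mono empty_iff empty_subsetI finite_lin_indpt2 rev_finite_subset)
  then have "S \<subseteq> board_col A ` {1..nc}" "lin_indpt S" using cols by (auto simp: maximal_def)
  then obtain J where J: "J \<subseteq> {1..nc}" "inj_on (board_col A) J" "S = board_col A ` J"
      "lin_indpt (board_col A ` J)"
    by (metis subset_image_inj)
  then have "col_indep (mat_entries A) J" by (simp add: col_indep_mat_entries_iff[OF A])
  moreover have "card J = rank A" using rank_card_indpt[OF A S] J(2,3) by (simp add: card_image)
  ultimately show ?thesis unfolding has_rank_def using upper by blast
qed

lemma mat_count_eq_sum:
  assumes B: "B \<subseteq> {1..m} \<times> {1..n}"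
  shows "mat_count TYPE('a::{field,finite}) m n d B =
    (\<Sum>\<sigma>\<in>Pow B. card (supp_rank_funs \<sigma> d :: (nat \<times> nat \<Rightarrow> 'a) set))"
proof -
  let ?M = "{A :: 'a mat. A \<in> carrier_mat m n \<and> vec_space.rank m A = d \<and> mat_support A \<subseteq> B}"
  let ?U = "\<Union>\<sigma>\<in>Pow B. supp_rank_funs \<sigma> d :: (nat \<times> nat \<Rightarrow> 'a) set"
  have finB: "finite B" using B finite_subset by blast
  have rank_iff: "has_rank (mat_entries A) d \<longleftrightarrow> vec_space.rank m A = d"
    if "A \<in> carrier_mat m n" for A :: "'a mat"
    using vec_space.has_rank_mat_entries[OF that] has_rank_unique by blast
  have "inj_on mat_entries (carrier_mat m n :: 'a mat set)"
    and surj: "mat_entries ` carrier_mat m n = {f :: nat \<times> nat \<Rightarrow> 'a. fun_supp f \<subseteq> {1..m} \<times> {1..n}}"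
    using bij_betw_mat_entries by (auto simp: bij_betw_def)
  then have "inj_on mat_entries ?M" by (auto intro: inj_on_subset)
  moreover have "mat_entries ` ?M = ?U"
  proof
    show "mat_entries ` ?M \<subseteq> ?U" using rank_iff by (auto simp: supp_rank_funs_def fun_supp_mat_entries)
    show "?U \<subseteq> mat_entries ` ?M"
    proof
      fix f assume "f \<in> ?U"
      then have f: "fun_supp f \<subseteq> B" "has_rank f d" by (auto simp: supp_rank_funs_def)
      then have "f \<in> mat_entries ` carrier_mat m n" unfolding surj using B by blast
      then obtain A where A: "A \<in> carrier_mat m n" "f = mat_entries A" by blast
      then show "f \<in> mat_entries ` ?M" using f rank_iff[OF A(1)] by (auto simp: fun_supp_mat_entries)
    qed
  qed
  ultimately have "mat_count TYPE('a) m n d B = card ?U"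
    using card_image[of mat_entries ?M] by (simp add: mat_count_def)
  also have "\<dots> = (\<Sum>\<sigma>\<in>Pow B. card (supp_rank_funs \<sigma> d :: (nat \<times> nat \<Rightarrow> 'a) set))"
  proof (rule card_UN_disjoint)
    show "\<forall>\<sigma>\<in>Pow B. finite (supp_rank_funs \<sigma> d :: (nat \<times> nat \<Rightarrow> 'a) set)"
      using finB finite_subset by (auto intro: finite_supp_rank_funs)
  qed (use finB in \<open>auto simp: supp_rank_funs_def\<close>)
  finally show ?thesis .
qed

lemma norm_mat_count_eq_sum_support_weight:
  assumes "B \<subseteq> {1..m} \<times> {1..n}"
  shows "norm_mat_count TYPE('a::{field,finite}) m n d B =
    of_int (\<Sum>\<sigma>\<in>Pow B. support_weight TYPE('a) d \<sigma>)"
proof -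
  let ?q = "int CARD('a)"
  have "finite B" using assms finite_subset by blast
  then have "finite \<sigma>" if "\<sigma> \<in> Pow B" for \<sigma> using that finite_subset by blast
  then have "int (mat_count TYPE('a) m n d B) = (?q - 1) ^ d * (\<Sum>\<sigma>\<in>Pow B. support_weight TYPE('a) d \<sigma>)"
    by (simp add: mat_count_eq_sum[OF assms] support_weight_mult sum_distrib_left)
  from arg_cong[OF this, of rat_of_int] show ?thesis
    using card_field_gt_1[where 'a = 'a] by (simp add: norm_mat_count_def)
qed

lemma rook_number_eq:
  assumes "finite B"
  shows "rook_number d B = card {\<sigma> \<in> Pow B. rook_placement \<sigma> \<and> card \<sigma> = d}"
proof -
  have "{\<sigma>. \<sigma> \<subseteq> B \<and> finite \<sigma> \<and> card \<sigma> = d \<and>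
     (\<forall>x\<in>\<sigma>. \<forall>y\<in>\<sigma>. x \<noteq> y \<longrightarrow> fst x \<noteq> fst y \<and> snd x \<noteq> snd y)} =
     {\<sigma> \<in> Pow B. rook_placement \<sigma> \<and> card \<sigma> = d}"
    unfolding rook_placement_def inj_on_def by blast
  then show ?thesis by (simp add: rook_number_def)
qed

theorem theorem3p10:
  fixes m n d q :: nat and B :: board
  assumes "B \<subseteq> {1..m} \<times> {1..n}"
    and "CARD('a::{field,finite}) = q"
  shows "\<exists>M :: int. norm_mat_count TYPE('a) m n d B = of_int M \<and>
    [M = int (rook_number d B) + (int q - 1) *
       (int (graph_rook_number ZG (int d - 2) m n B)
        - int (graph_rook_number SG (int d - 2) m n B)
        + int (graph_rook_number WRG (int d - 1) m n B)
        + int (graph_rook_number WCG (int d - 1) m n B))] (mod (int q - 1)\<^sup>2)"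
proof (intro exI conjI)
  let ?M = "\<Sum>\<sigma>\<in>Pow B. support_weight TYPE('a) d \<sigma>"
  show "norm_mat_count TYPE('a) m n d B = of_int ?M"
    by (rule norm_mat_count_eq_sum_support_weight[OF assms(1)])
  have finB: "finite B" using assms(1) finite_subset by blast
  have count: "(\<Sum>\<sigma>\<in>Pow B. of_bool (P \<sigma>)) = int (card {\<sigma> \<in> Pow B. P \<sigma>})" for P
    using finB by (simp add: Int_def)
  show "[?M = int (rook_number d B) + (int q - 1) *
       (int (graph_rook_number ZG (int d - 2) m n B)
        - int (graph_rook_number SG (int d - 2) m n B)
        + int (graph_rook_number WRG (int d - 1) m n B)
        + int (graph_rook_number WCG (int d - 1) m n B))] (mod (int q - 1)\<^sup>2)"
    unfolding rook_number_eq[OF finB] count[symmetric] assms(2)[symmetric]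
      no_isolated_vertices_exceptional[THEN graph_rook_number_eq[OF assms(1)]]
      sum.distrib[symmetric] sum_subtractf[symmetric] sum_distrib_left
    by (intro cong_sum support_weight_cong) (use finB finite_subset in blast)
qed

end
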